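(* Let $n\ge2$ and let $(\mathfrak g,[\cdot,\cdots,\cdot],\alpha)$ be an $n$-ary multiplicative Hom-Nambu-Lie superalgebra. Then $(\mathrm{Der}(\mathfrak g),[\cdot,\cdot])$, where $\mathrm{Der}(\mathfrak g)=\bigoplus_{k\ge0}\mathrm{Der}_{\alpha^k}(\mathfrak g)$ and the bracket is the usual (super)commutator $[D,D']=D\circ D'-(-1)^{|D||D'|}D'\circ D$, is a Lie superalgebra, and $\mathrm{Inn}(\mathfrak g)=\bigoplus_{k\ge0}\mathrm{Inn}_{\alpha^k}(\mathfrak g)$ is an ideal of it.
   Context: All vector spaces are over a fixed field $\mathbb{K}$. For a $\mathbb{Z}_2$-graded vector space $\mathfrak g=\mathfrak g_{\bar 0}\oplus\mathfrak g_{\bar 1}$, $|x|\in\mathbb{Z}_2$ denotes the degree of a homogeneous element $x$; whenever $|x|$ appears, $x$ is assumed homogeneous. $\mathrm{End}(\mathfrak g)$ is $\mathbb{Z}_2$-graded in the usual way and $|D|$ is the degree of a homogeneous $D\in\mathrm{End}(\mathfrak g)$; formulas involving $|D|$ are stated for homogeneous $D$ and extended linearly. An $n$-ary multiplicative Hom-Nambu-Lie superalgebra is a triple $(\mathfrak g,[\cdot,\cdots,\cdot],\alpha)$ consisting of a $\mathbb{Z}_2$-graded vector space $\mathfrak g$, an $n$-linear map $[\cdot,\cdots,\cdot]:\mathfrak g\times\cdots\times\mathfrak g\to\mathfrak g$ and an even (degree-preserving) linear map $\alpha:\mathfrak g\to\mathfrak g$ such that, for all homogeneous elements: (1) $|[x_1,\cdots,x_n]|=|x_1|+\cdots+|x_n|$;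 (2) $[x_1,\cdots,x_i,x_{i+1},\cdots,x_n]=-(-1)^{|x_i||x_{i+1}|}[x_1,\cdots,x_{i+1},x_i,\cdots,x_n]$ for $1\le i\le n-1$; (3) $[\alpha(x_1),\cdots,\alpha(x_{n-1}),[y_1,\cdots,y_n]]=\sum_{i=1}^n(-1)^{(|x_1|+\cdots+|x_{n-1}|)(|y_1|+\cdots+|y_{i-1}|)}[\alpha(y_1),\cdots,\alpha(y_{i-1}),[x_1,\cdots,x_{n-1},y_i],\alpha(y_{i+1}),\cdots,\alpha(y_n)]$; (4) $\alpha[x_1,\cdots,x_n]=[\alpha(x_1),\cdots,\alpha(x_n)]$. $\alpha^k$ is the $k$-fold composition of $\alpha$, $\alpha^0=\mathrm{id}$. For $k\ge0$, an $\alpha^k$-derivation is $D\in\mathrm{End}(\mathfrak g)$ with $D\circ\alpha=\alpha\circ D$ and $$D[x_1,\cdots,x_n]=\sum_{i=1}^n(-1)^{|D|(|x_1|+\cdots+|x_{i-1}|)}[\alpha^k(x_1),\cdots,\alpha^k(x_{i-1}),D(x_i),\alpha^k(x_{i+1}),\cdots,\alpha^k(x_n)]$$ for all homogeneous $x_1,\dots,x_n\in\mathfrak g$. $\mathrm{Der}_{\alpha^k}(\mathfrak g)$ denotes the (graded) space of $\alpha^k$-derivations, i.e. the span of the homogeneous ones. The sum $\bigoplus_{k\ge0}\mathrm{Der}_{\alpha^k}(\mathfrak g)$ is the (external) direct sum, with bracket extended bilinearly from the commutators $\mathrm{Der}_{\alpha^k}(\mathfrak g)\times\mathrm{Der}_{\alpha^{k'}}(\mathfrak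 g)\to\mathrm{Der}_{\alpha^{k+k'}}(\mathfrak g)$. Let $\mathfrak g^{\wedge^{n-1}}$ be the $(n-1)$-st exterior power in the super sense (adjacent factors satisfy $x\wedge y=-(-1)^{|x||y|}y\wedge x$), on which $\alpha$ acts by $\alpha(x_1\wedge\cdots\wedge x_{n-1})=\alpha(x_1)\wedge\cdots\wedge\alpha(x_{n-1})$. For $\mathscr X\in\mathfrak g^{\wedge^{n-1}}$ with $\alpha(\mathscr X)=\mathscr X$ and $k\ge0$, define $\mathrm{ad}_k(\mathscr X)\in\mathrm{End}(\mathfrak g)$ by $\mathrm{ad}_k(\mathscr X)(y)=[x_1,\cdots,x_{n-1},\alpha^k(y)]$ for $\mathscr X=x_1\wedge\cdots\wedge x_{n-1}$, extended linearly in $\mathscr X$. The map $\mathrm{ad}_k(\mathscr X)$ is an $\alpha^{k+1}$-derivation, called an inner $\alpha^{k+1}$-derivation. $\mathrm{Inn}_{\alpha^k}(\mathfrak g)$ denotes the $\mathbb{K}$-vector space generated by all inner $\alpha^{k+1}$-derivations $\mathrm{ad}_k(\mathscr X)$; it is regarded as a subspace of the summand $\mathrm{Der}_{\alpha^{k+1}}(\mathfrak g)$ of $\mathrm{Der}(\mathfrak g)$. *)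

theory Defs
  imports
    Complex_Main
    "HOL-Library.Z2"
    "HOL-Library.Function_Algebras"
    "HOL-Library.Poly_Mapping"
begin

text \<open>Degrees in \<open>\<int>\<^sub>2\<close> are of type \<^typ>\<open>bit\<close>. Statements about homogeneous elements are quantified
  over an element \<open>x\<close> together with a degree \<open>p\<close> such that \<open>x \<in> V p\<close>. Only \<open>0\<close> has more than one
  degree, and all the identities below are trivial when some argument is \<open>0\<close>.\<close>

definition koszul :: "bit \<Rightarrow> 'k::field" where
  "koszul p = (if p = 1 then - 1 else 1)"

section \<open>Graded vector spaces and Lie superalgebras\<close>

locale super_space = vector_space scale
  for scale :: "'k::field \<Rightarrow> 'a::ab_group_add \<Rightarrow> 'a" +
  fixes A :: "'a set"
    and V :: "bit \<Rightarrow> 'a set"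
  assumes subspace_part: "subspace (V p)"
    and parts_disjoint: "V 0 \<inter> V 1 = {0}"
    and parts_span: "A = {x + y |x y. x \<in> V 0 \<and> y \<in> V 1}"

text \<open>These are the axioms of an \<open>n\<close>-ary Hom-Nambu-Lie superalgebra (below) for \<open>n = 2\<close> and
  \<open>\<alpha> = id\<close>; the ground field is arbitrary and no further axioms are imposed in
  characteristic \<open>2\<close> or \<open>3\<close>. The bracket is only relevant on the carrier \<open>A\<close>.\<close>

locale lie_superalgebra = super_space scale A V
  for scale :: "'k::field \<Rightarrow> 'a::ab_group_add \<Rightarrow> 'a"
    and A :: "'a set"
    and V :: "bit \<Rightarrow> 'a set" +
  fixes br :: "'a \<Rightarrow> 'a \<Rightarrow> 'a"
  assumes br_add_left: "\<lbrakk>x \<in> A; y \<in> A; z \<in> A\<rbrakk> \<Longrightarrow> br (x + y) z = br x z + br y z"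
    and br_add_right: "\<lbrakk>x \<in> A; y \<in> A; z \<in> A\<rbrakk> \<Longrightarrow> br x (y + z) = br x y + br x z"
    and br_scale_left: "\<lbrakk>x \<in> A; y \<in> A\<rbrakk> \<Longrightarrow> br (scale c x) y = scale c (br x y)"
    and br_scale_right: "\<lbrakk>x \<in> A; y \<in> A\<rbrakk> \<Longrightarrow> br x (scale c y) = scale c (br x y)"
    and br_degree: "\<lbrakk>x \<in> V p; y \<in> V q\<rbrakk> \<Longrightarrow> br x y \<in> V (p + q)"
    and br_skew: "\<lbrakk>x \<in> V p; y \<in> V q\<rbrakk> \<Longrightarrow> br x y = - scale (koszul (p * q)) (br y x)"
    and br_jacobi: "\<lbrakk>x \<in> V p; y \<in> V q; z \<in> V r\<rbrakk> \<Longrightarrow>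
      br x (br y z) = br (br x y) z + scale (koszul (p * q)) (br y (br x z))"
begin

text \<open>Ideals are understood to be graded subspaces.\<close>

definition ideal :: "'a set \<Rightarrow> bool" where
  "ideal I \<longleftrightarrow> subspace I \<and> I \<subseteq> A \<and>
    (\<forall>x\<in>V 0. \<forall>y\<in>V 1. x + y \<in> I \<longrightarrow> x \<in> I \<and> y \<in> I) \<and>
    (\<forall>x\<in>A. \<forall>y\<in>I. br x y \<in> I \<and> br y x \<in> I)"

end

section \<open>Multiplicative Hom-Nambu-Lie superalgebras\<close>

text \<open>The underlying vector space is the whole type \<open>'v\<close>. The \<open>n\<close>-ary bracket is a function on lists,
  of which only the values on lists of length \<open>n\<close> matter; positions are numbered from \<open>0\<close>.\<close>

abbreviation homogeneous :: "(bit \<Rightarrow> 'v set) \<Rightarrow> 'v list \<Rightarrow> bit list \<Rightarrow> bool" where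
  "homogeneous V xs ps \<equiv> list_all2 (\<lambda>x p. x \<in> V p) xs ps"

definition swap_adj :: "nat \<Rightarrow> 'v list \<Rightarrow> 'v list" where
  "swap_adj i xs = xs[i := xs ! Suc i, Suc i := xs ! i]"

locale hom_nambu_lie_superalgebra = super_space scale UNIV V
  for scale :: "'k::field \<Rightarrow> 'v::ab_group_add \<Rightarrow> 'v"
    and V :: "bit \<Rightarrow> 'v set" +
  fixes n :: nat
    and br :: "'v list \<Rightarrow> 'v"
    and \<alpha> :: "'v \<Rightarrow> 'v"
  assumes br_add: "\<lbrakk>length xs = n; i < n\<rbrakk> \<Longrightarrow>
      br (xs[i := x + y]) = br (xs[i := x]) + br (xs[i := y])"
    and br_scale: "\<lbrakk>length xs = n; i < n\<rbrakk> \<Longrightarrow>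
      br (xs[i := scale c x]) = scale c (br (xs[i := x]))"
    and linear_alpha: "Vector_Spaces.linear scale scale \<alpha>"
    and even_alpha: "x \<in> V p \<Longrightarrow> \<alpha> x \<in> V p"
    and br_degree: "\<lbrakk>length xs = n; homogeneous V xs ps\<rbrakk> \<Longrightarrow> br xs \<in> V (sum_list ps)"
    and br_skew: "\<lbrakk>length xs = n; homogeneous V xs ps; Suc i < n\<rbrakk> \<Longrightarrow>
      br xs = - scale (koszul (ps ! i * ps ! Suc i)) (br (swap_adj i xs))"
    and br_hom_nambu:
      "\<lbrakk>length xs = n - 1; homogeneous V xs ps; length ys = n; homogeneous V ys qs\<rbrakk> \<Longrightarrow>
      br (map \<alpha> xs @ [br ys]) =
        (\<Sum>i<n. scale (koszul (sum_list ps * sum_list (take i qs)))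
                  (br ((map \<alpha> ys)[i := br (xs @ [ys ! i])])))"
    and alpha_br: "\<lbrakk>length xs = n; homogeneous V xs ps\<rbrakk> \<Longrightarrow> \<alpha> (br xs) = br (map \<alpha> xs)"
begin

subsection \<open>Derivations\<close>

definition End_part :: "bit \<Rightarrow> ('v \<Rightarrow> 'v) set" where
  "End_part p = {D. Vector_Spaces.linear scale scale D \<and> (\<forall>q. D ` V q \<subseteq> V (p + q))}"

abbreviation End_scale :: "'k \<Rightarrow> ('v \<Rightarrow> 'v) \<Rightarrow> 'v \<Rightarrow> 'v" where
  "End_scale \<equiv> \<lambda>c D x. scale c (D x)"

definition Der_part :: "nat \<Rightarrow> bit \<Rightarrow> ('v \<Rightarrow> 'v) set" where
  "Der_part k p = {D \<in> End_part p. D \<circ> \<alpha> = \<alpha> \<circ> D \<and>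
    (\<forall>xs ps. length xs = n \<and> homogeneous V xs ps \<longrightarrow>
      D (br xs) = (\<Sum>i<n. scale (koszul (p * sum_list (take i ps)))
                           (br ((map (\<alpha> ^^ k) xs)[i := D (xs ! i)]))))}"

definition Der :: "nat \<Rightarrow> ('v \<Rightarrow> 'v) set" where
  "Der k = module.span End_scale (\<Union>p. Der_part k p)"

definition proj :: "bit \<Rightarrow> 'v \<Rightarrow> 'v" where
  "proj p x = (THE a. a \<in> V p \<and> x - a \<in> V (p + 1))"

definition End_proj :: "bit \<Rightarrow> ('v \<Rightarrow> 'v) \<Rightarrow> 'v \<Rightarrow> 'v" where
  "End_proj p D x = (\<Sum>q\<in>UNIV. proj (p + q) (D (proj q x)))"

text \<open>The bilinear extension of \<open>[D, D'] = D \<circ> D' - (-1)\<^bsup>|D||D'|\<^esup> D' \<circ> D\<close> from homogeneous to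
  arbitrary endomorphisms.\<close>

definition supercommutator :: "('v \<Rightarrow> 'v) \<Rightarrow> ('v \<Rightarrow> 'v) \<Rightarrow> 'v \<Rightarrow> 'v" where
  "supercommutator D D' x =
    (\<Sum>p\<in>UNIV. \<Sum>q\<in>UNIV. End_proj p D (End_proj q D' x)
        - scale (koszul (p * q)) (End_proj q D' (End_proj p D x)))"

text \<open>An element of the external direct sum is a finitely supported sequence whose \<open>k\<close>-th entry lies
  in the \<open>k\<close>-th summand.\<close>

abbreviation sum_scale :: "'k \<Rightarrow> (nat \<Rightarrow> 'v \<Rightarrow> 'v) \<Rightarrow> nat \<Rightarrow> 'v \<Rightarrow> 'v" where
  "sum_scale \<equiv> \<lambda>c D k x. scale c (D k x)"

definition Der_sum :: "(nat \<Rightarrow> 'v \<Rightarrow> 'v) set" where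
  "Der_sum = {D. (\<forall>k. D k \<in> Der k) \<and> finite {k. D k \<noteq> 0}}"

definition Der_sum_part :: "bit \<Rightarrow> (nat \<Rightarrow> 'v \<Rightarrow> 'v) set" where
  "Der_sum_part p = {D \<in> Der_sum. \<forall>k. D k \<in> End_part p}"

definition Der_bracket :: "(nat \<Rightarrow> 'v \<Rightarrow> 'v) \<Rightarrow> (nat \<Rightarrow> 'v \<Rightarrow> 'v) \<Rightarrow> nat \<Rightarrow> 'v \<Rightarrow> 'v" where
  "Der_bracket D E m = (\<Sum>k\<le>m. supercommutator (D k) (E (m - k)))"

subsection \<open>The super exterior power\<close>

text \<open>The \<open>m\<close>-th super exterior power is the quotient of the vector space with basis all lists of
  length \<open>m\<close> (the list \<open>[x\<^sub>1, \<dots>, x\<^sub>m]\<close> standing for \<open>x\<^sub>1 \<and> \<dots> \<and> x\<^sub>m\<close>) by multilinearity and super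
  skew-symmetry in adjacent homogeneous factors. Its elements are the equivalence classes.\<close>

definition form_scale :: "'k \<Rightarrow> ('v list \<Rightarrow>\<^sub>0 'k) \<Rightarrow> 'v list \<Rightarrow>\<^sub>0 'k" where
  "form_scale c f = Poly_Mapping.map ((*) c) f"

definition forms :: "nat \<Rightarrow> ('v list \<Rightarrow>\<^sub>0 'k) set" where
  "forms m = {f. \<forall>xs\<in>Poly_Mapping.keys f. length xs = m}"

abbreviation wedge :: "'v list \<Rightarrow> 'v list \<Rightarrow>\<^sub>0 'k" where
  "wedge xs \<equiv> Poly_Mapping.single xs 1"

definition wedge_relators :: "nat \<Rightarrow> ('v list \<Rightarrow>\<^sub>0 'k) set" where
  "wedge_relators m =
    {wedge (xs[i := x + y]) - wedge (xs[i := x]) - wedge (xs[i := y]) |xs i x y.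
       length xs = m \<and> i < m} \<union>
    {wedge (xs[i := scale c x]) - form_scale c (wedge (xs[i := x])) |xs i c x.
       length xs = m \<and> i < m} \<union>
    {wedge xs + form_scale (koszul (p * q)) (wedge (swap_adj i xs)) |xs i p q.
       length xs = m \<and> Suc i < m \<and> xs ! i \<in> V p \<and> xs ! Suc i \<in> V q}"

definition ext_rel :: "nat \<Rightarrow> (('v list \<Rightarrow>\<^sub>0 'k) \<times> ('v list \<Rightarrow>\<^sub>0 'k)) set" where
  "ext_rel m = {(f, g). f \<in> forms m \<and> g \<in> forms m \<and>
    f - g \<in> module.span form_scale (wedge_relators m)}"

definition ext_power :: "nat \<Rightarrow> ('v list \<Rightarrow>\<^sub>0 'k) set set" where
  "ext_power m = forms m // ext_rel m"

definition form_alpha :: "('v list \<Rightarrow>\<^sub>0 'k) \<Rightarrow> 'v list \<Rightarrow>\<^sub>0 'k" where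
  "form_alpha f = (\<Sum>xs\<in>Poly_Mapping.keys f.
     form_scale (Poly_Mapping.lookup f xs) (wedge (map \<alpha> xs)))"

definition ext_alpha :: "nat \<Rightarrow> ('v list \<Rightarrow>\<^sub>0 'k) set \<Rightarrow> ('v list \<Rightarrow>\<^sub>0 'k) set" where
  "ext_alpha m X = (\<Union>f\<in>X. ext_rel m `` {form_alpha f})"

subsection \<open>Inner derivations\<close>

definition form_ad :: "nat \<Rightarrow> ('v list \<Rightarrow>\<^sub>0 'k) \<Rightarrow> 'v \<Rightarrow> 'v" where
  "form_ad k f y = (\<Sum>xs\<in>Poly_Mapping.keys f.
     scale (Poly_Mapping.lookup f xs) (br (xs @ [(\<alpha> ^^ k) y])))"

definition ad :: "nat \<Rightarrow> ('v list \<Rightarrow>\<^sub>0 'k) set \<Rightarrow> 'v \<Rightarrow> 'v" where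
  "ad k X = the_elem (form_ad k ` X)"

definition Inn :: "nat \<Rightarrow> ('v \<Rightarrow> 'v) set" where
  "Inn k = module.span End_scale
    {ad k X |X. X \<in> ext_power (n - 1) \<and> ext_alpha (n - 1) X = X}"

text \<open>\<open>Inn k\<close> consists of \<open>\<alpha>\<^bsup>k+1\<^esup>\<close>-derivations, so it sits in the summand with index \<open>Suc k\<close>.\<close>

definition Inn_sum :: "(nat \<Rightarrow> 'v \<Rightarrow> 'v) set" where
  "Inn_sum = {D. D 0 = 0 \<and> (\<forall>k. D (Suc k) \<in> Inn k) \<and> finite {k. D k \<noteq> 0}}"

subsection \<open>The inner derivations do not depend on representatives\<close>

text \<open>The last lemma of this section shows that \<open>the_elem\<close> in the definition of \<^const>\<open>ad\<close> is
  always applied to a singleton.\<close>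


lemma vector_space_End: "vector_space End_scale"
  by (standard; simp add: fun_eq_iff scale_right_distrib scale_left_distrib)

lemma vector_space_sum: "vector_space sum_scale"
  by (standard; simp add: fun_eq_iff scale_right_distrib scale_left_distrib)

lemma form_lookup [simp]: "Poly_Mapping.lookup (form_scale c f) xs = c * Poly_Mapping.lookup f xs"
  by (simp add: form_scale_def map.rep_eq when_def)

lemma vector_space_form: "vector_space form_scale"
  by standard (rule poly_mapping_eqI; simp add: lookup_add algebra_simps)+

lemma form_ad_superset:
  assumes "finite K" "Poly_Mapping.keys f \<subseteq> K"
  shows "form_ad k f y = (\<Sum>xs\<in>K. scale (Poly_Mapping.lookup f xs) (br (xs @ [(\<alpha> ^^ k) y])))"
  unfolding form_ad_def using assms by (intro sum.mono_neutral_left) (auto simp: in_keys_iff)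

lemma form_ad_add: "form_ad k (f + g) y = form_ad k f y + form_ad k g y"
proof -
  let ?K = "Poly_Mapping.keys f \<union> Poly_Mapping.keys g"
  have "Poly_Mapping.keys (f + g) \<subseteq> ?K" by (rule Poly_Mapping.keys_add)
  then show ?thesis
    by (simp add: form_ad_superset[where K = ?K] lookup_add scale_left_distrib sum.distrib)
qed

lemma form_ad_scale: "form_ad k (form_scale c f) y = scale c (form_ad k f y)"
proof -
  have "Poly_Mapping.keys (form_scale c f) \<subseteq> Poly_Mapping.keys f" by (auto simp: in_keys_iff)
  then show ?thesis
    by (simp add: form_ad_superset[where K = "Poly_Mapping.keys f"] scale_sum_right)
qed

lemma form_ad_minus: "form_ad k (f - g) y = form_ad k f y - form_ad k g y"
  using form_ad_add[of k "f - g" g y] by simp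

lemma form_ad_wedge: "form_ad k (wedge xs) y = br (xs @ [(\<alpha> ^^ k) y])"
  by (simp add: form_ad_def)

lemma decomp: "\<exists>a b. a \<in> V 0 \<and> b \<in> V 1 \<and> x = a + b"
proof -
  have "x \<in> {x + y |x y. x \<in> V 0 \<and> y \<in> V 1}" using parts_span by blast
  then show ?thesis by blast
qed

lemma skew_general:
  assumes "length xs = n" "Suc i < n" "xs ! i \<in> V p" "xs ! Suc i \<in> V q"
  shows "br xs = - scale (koszul (p * q)) (br (swap_adj i xs))"
proof -
  have *: "finite J \<Longrightarrow> J \<subseteq> {..<n} - {i, Suc i} \<Longrightarrow> 
     (\<forall>xs. length xs = n \<longrightarrow> xs ! i \<in> V p \<longrightarrow> xs ! Suc i \<in> V q \<longrightarrow>
       (\<forall>j\<in>{..<n} - {i, Suc i} - J. \<exists>r. xs ! j \<in> V r) \<longrightarrow>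
      br xs = - scale (koszul (p * q)) (br (swap_adj i xs)))" for J
  proof (induction J rule: finite_induct)
    case empty
    show ?case
    proof (intro allI impI)
      fix xs assume a: "length xs = n" "xs ! i \<in> V p" "xs ! Suc i \<in> V q"
        "\<forall>j\<in>{..<n} - {i, Suc i} - {}. \<exists>r. xs ! j \<in> V r"
      have "\<forall>j. \<exists>r. j < n \<longrightarrow> xs ! j \<in> V r \<and> (j = i \<longrightarrow> r = p) \<and> (j = Suc i \<longrightarrow> r = q)"
      proof
        fix j
        show "\<exists>r. j < n \<longrightarrow> xs ! j \<in> V r \<and> (j = i \<longrightarrow> r = p) \<and> (j = Suc i \<longrightarrow> r = q)"
          using a by (cases "j = i \<or> j = Suc i") auto
      qed
      from choice[OF this] obtain r where
        r: "\<forall>j. j < n \<longrightarrow> xs ! j \<in> V (r j) \<and> (j = i \<longrightarrow> r j = p) \<and> (j = Suc i \<longrightarrow> r j = q)"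
        by blast
      have i: "i < n" using assms(2) by simp
      have ri: "r i = p" "r (Suc i) = q" using r i assms(2) by blast+
      have H: "homogeneous V xs (map r [0..<n])"
        using r a(1) by (simp add: list_all2_conv_all_nth)
      have e: "map r [0..<n] ! i = p" "map r [0..<n] ! Suc i = q" using i assms(2) ri by simp_all
      show "br xs = - scale (koszul (p * q)) (br (swap_adj i xs))"
        using br_skew[OF a(1) H assms(2)] unfolding e .
    qed
  next
    case (insert j J)
    show ?case
    proof (intro allI impI)
      fix xs assume a: "length xs = n" "xs ! i \<in> V p" "xs ! Suc i \<in> V q"
        "\<forall>j'\<in>{..<n} - {i, Suc i} - insert j J. \<exists>r. xs ! j' \<in> V r"
      have j: "j < n" "j \<noteq> i" "j \<noteq> Suc i" using insert.prems by auto
      obtain u v where uv: "u \<in> V 0" "v \<in> V 1" "xs ! j = u + v" using decomp by metis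
      have IH: "br (xs[j := w]) = - scale (koszul (p * q)) (br (swap_adj i (xs[j := w])))" if "w \<in> V s" for w s
      proof -
        have p: "J \<subseteq> {..<n} - {i, Suc i}" "length (xs[j := w]) = n" "xs[j := w] ! i \<in> V p"
          "xs[j := w] ! Suc i \<in> V q" using insert.prems a j by auto
        have "\<forall>j'\<in>{..<n} - {i, Suc i} - J. \<exists>r. xs[j := w] ! j' \<in> V r"
        proof
          fix j' assume j': "j' \<in> {..<n} - {i, Suc i} - J"
          show "\<exists>r. xs[j := w] ! j' \<in> V r"
          proof (cases "j' = j")
            case True then show ?thesis using that a(1) j by auto
          next
            case False then show ?thesis using a(4) j' by (metis DiffE DiffI insert_iff nth_list_update_neq)
          qed
        qed
        with p insert.IH show ?thesis by blast
      qed
      have sw: "swap_adj i (xs[j := w]) = (swap_adj i xs)[j := w]" for w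
        using j by (simp add: swap_adj_def list_update_swap)
      have 1: "br xs = br (xs[j := u]) + br (xs[j := v])"
        using br_add[OF a(1) j(1), of u v] uv(3) list_update_id[of xs j] by simp
      have "(swap_adj i xs) ! j = xs ! j" using j by (simp add: swap_adj_def)
      then have 2: "br (swap_adj i xs) = br ((swap_adj i xs)[j := u]) + br ((swap_adj i xs)[j := v])"
        using br_add[of "swap_adj i xs" j u v] a(1) j(1) uv(3) list_update_id[of "swap_adj i xs" j] by (simp add: swap_adj_def)
      show "br xs = - scale (koszul (p * q)) (br (swap_adj i xs))"
        unfolding 1 2 using IH[OF uv(1)] IH[OF uv(2)] unfolding sw by (simp add: scale_right_distrib)
    qed
  qed
  have e: "\<forall>j\<in>{..<n} - {i, Suc i} - ({..<n} - {i, Suc i}). \<exists>r. xs ! j \<in> V r" by simp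
  have f: "finite ({..<n} - {i, Suc i})" by simp
  show ?thesis
    using *[OF f subset_refl] assms e by blast
qed

lemma form_ad_relator:
  assumes "f \<in> module.span form_scale (wedge_relators (n - 1))" "n \<ge> 1"
  shows "form_ad k f y = 0"
proof -
  interpret F: vector_space form_scale by (rule vector_space_form)
  show ?thesis using assms(1)
  proof (induction rule: F.span_induct)
    case base
    have 0: "form_ad k 0 y = 0" by (simp add: form_ad_def)
    then show ?case by (auto simp: F.subspace_def form_ad_add form_ad_scale)
  next
    case (step f)
    consider (a) xs i x z where "length xs = n - 1" "i < n - 1"
        "f = wedge (xs[i := x + z]) - wedge (xs[i := x]) - wedge (xs[i := z])"
      | (b) xs i c x where "length xs = n - 1" "i < n - 1"
        "f = wedge (xs[i := scale c x]) - form_scale c (wedge (xs[i := x]))"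
      | (c) xs i p q where "length xs = n - 1" "Suc i < n - 1" "xs ! i \<in> V p" "xs ! Suc i \<in> V q"
        "f = wedge xs + form_scale (koszul (p * q)) (wedge (swap_adj i xs))"
      using step unfolding wedge_relators_def by (elim UnE CollectE exE conjE) (rule that, assumption+)+
    then show ?case
    proof cases
      case a
      with a assms br_add[of "xs @ [(\<alpha> ^^ k) y]" i x z] show ?thesis
        by (simp add: form_ad_minus form_ad_wedge list_update_append)
    next
      case b
      with b assms br_scale[of "xs @ [(\<alpha> ^^ k) y]" i c x] show ?thesis
        by (simp add: form_ad_minus form_ad_wedge form_ad_scale list_update_append)
    next
      case c
      have "swap_adj i (xs @ [t]) = swap_adj i xs @ [t]" for t
        using c by (simp add: list_update_append nth_append swap_adj_def)
      moreover have "br (xs @ [t]) = - scale (koszul (p * q)) (br (swap_adj i (xs @ [t])))" for t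
        using skew_general[of "xs @ [t]" i p q] c assms by (simp add: nth_append)
      ultimately show ?thesis
        unfolding c(5) form_ad_add form_ad_wedge form_ad_scale by (metis add.left_inverse)
    qed
  qed
qed

lemma ad_class:
  assumes "f \<in> forms (n - 1)" "n \<ge> 1"
  shows "ad k (ext_rel (n - 1) `` {f}) = form_ad k f"
proof -
  interpret F: vector_space form_scale by (rule vector_space_form)
  have "form_ad k g = form_ad k f" if "(f, g) \<in> ext_rel (n - 1)" for g
  proof
    fix y
    have "form_ad k (f - g) y = 0"
      using that assms(2) form_ad_relator unfolding ext_rel_def by blast
    then show "form_ad k g y = form_ad k f y" unfolding form_ad_minus by (metis eq_iff_diff_eq_0)
  qed
  moreover have "(f, f) \<in> ext_rel (n - 1)" using assms by (simp add: ext_rel_def F.span_zero)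
  ultimately have "form_ad k ` (ext_rel (n - 1) `` {f}) = {form_ad k f}" by blast
  then show ?thesis by (simp only: ad_def the_elem_eq)
qed
end

end

theory Submission
  imports Defs "HOL-Library.Multiset"
begin

text \<open>The composite of two homogeneous derivations applied to \<open>[x\<^sub>1, \<dots>, x\<^sub>n]\<close> is a double sum over the
  positions \<open>i\<close>, \<open>j\<close> on which they act. In the supercommutator the terms with \<open>i \<noteq> j\<close> cancel, because
  derivations commute with \<open>\<alpha>\<close>, and the remaining ones say that it is an \<open>\<alpha>\<^bsup>k+l\<^esup>\<close>-derivation.

  For the ideal, a homogeneous \<open>\<alpha>\<^bsup>l\<^esup>\<close>-derivation \<open>D\<close> acts on the exterior power by
  \<open>D \<cdot> (x\<^sub>1 \<and> \<dots> \<and> x\<^sub>m) = \<Sum>\<^sub>i \<plusminus> \<alpha>\<^bsup>l\<^esup> x\<^sub>1 \<and> \<dots> \<and> D x\<^sub>i \<and> \<dots> \<and> \<alpha>\<^bsup>l\<^esup> x\<^sub>m\<close>. This action commutes with \<open>\<alpha>\<close>, so it preserves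
  the fixed points of \<open>\<alpha>\<close>, and \<open>[D, ad\<^sub>k X] = ad\<^bsub>k+l\<^esub> (D \<cdot> X)\<close> whenever \<open>\<alpha> X = X\<close>. The homogeneous
  components of a fixed point are fixed points as \<open>\<alpha>\<close> is even, which makes the ideal graded.\<close>

text \<open>These rules would rewrite sums and products of degrees to bit operations.\<close>

declare add_bit_eq_xor [simp del] mult_bit_eq_and [simp del]

section \<open>Degrees, Koszul signs and triangular sums\<close>

lemma UNIV_bit: "(UNIV :: bit set) = {0, 1}"
  by (auto intro: bit.exhaust)

lemma sum_bit: "(\<Sum>p\<in>(UNIV :: bit set). f p) = f 0 + f 1"
  by (simp add: UNIV_bit)

lemma bit_add_self [simp]: "p + p = (0 :: bit)" "p + (p + q) = (q :: bit)"
  by (cases p; cases q; simp)+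

lemma koszul_0 [simp]: "koszul 0 = 1"
  by (simp add: koszul_def)

lemma koszul_add: "koszul (p + q) = koszul p * koszul q"
  by (cases p; cases q; simp add: koszul_def)

lemma koszul_square [simp]: "koszul p * koszul p = 1" "koszul p * (koszul p * c) = c"
  by (cases p; simp add: koszul_def)+

text \<open>Both sides run over the triples with i + j + l = m, the left one grouped by a = i + j.
  Since \<open>Der_bracket\<close> is a convolution, this reindexing and the following one reduce
  its Jacobi identity to that of single triples of components.\<close>

lemma sum_triangle_assoc:
  fixes h :: "nat \<Rightarrow> nat \<Rightarrow> nat \<Rightarrow> 'b::comm_monoid_add"
  shows "(\<Sum>a\<le>m. \<Sum>i\<le>a. h i (a - i) (m - a)) = (\<Sum>i\<le>m. \<Sum>j\<le>m - i. h i j (m - i - j))"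
  by (simp add: sum.Sigma)
    (rule sum.reindex_bij_witness[where i = "\<lambda>(i, j). (i + j, i)" and j = "\<lambda>(a, i). (i, a - i)"], auto)

lemma sum_triangle_swap:
  fixes h :: "nat \<Rightarrow> nat \<Rightarrow> nat \<Rightarrow> 'b::comm_monoid_add"
  shows "(\<Sum>j\<le>m. \<Sum>i\<le>m - j. h i j (m - j - i)) = (\<Sum>i\<le>m. \<Sum>j\<le>m - i. h i j (m - i - j))"
  by (simp add: sum.Sigma)
    (rule sum.reindex_bij_witness[where i = "\<lambda>(i, j). (j, i)" and j = "\<lambda>(i, j). (j, i)"],
      auto simp: add.commute)

section \<open>Adjacent exchanges and factorwise maps on lists\<close>

lemma length_swap_adj [simp]: "length (swap_adj i xs) = length xs"
  by (simp add: swap_adj_def)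

lemma swap_adj_swap_adj: "Suc i < length xs \<Longrightarrow> swap_adj i (swap_adj i xs) = xs"
  by (rule nth_equalityI) (auto simp: swap_adj_def nth_list_update)

lemma sum_list_swap_adj:
  fixes xs :: "'b::comm_monoid_add list"
  assumes "Suc i < length xs"
  shows "sum_list (swap_adj i xs) = sum_list xs"
proof -
  have "mset (swap_adj i xs) = mset xs"
    using assms by (simp add: swap_adj_def mset_swap)
  then show ?thesis by (metis sum_mset_sum_list)
qed

lemma map_swap_adj: "Suc i < length xs \<Longrightarrow> map f (swap_adj i xs) = swap_adj i (map f xs)"
  by (simp add: swap_adj_def map_update)

definition tensor :: "('a \<Rightarrow> 'b) list \<Rightarrow> 'a list \<Rightarrow> 'b list" where
  "tensor gs xs = map2 (\<lambda>g x. g x) gs xs"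

lemma length_tensor [simp]: "length (tensor gs xs) = min (length gs) (length xs)"
  by (simp add: tensor_def)

lemma nth_tensor: "i < length gs \<Longrightarrow> i < length xs \<Longrightarrow> tensor gs xs ! i = (gs ! i) (xs ! i)"
  by (simp add: tensor_def)

lemma tensor_update:
  "length xs = length gs \<Longrightarrow> i < length gs \<Longrightarrow> tensor gs (xs[i := x]) = (tensor gs xs)[i := (gs ! i) x]"
  by (rule nth_equalityI) (auto simp: nth_tensor nth_list_update)

lemma tensor_swap_adj:
  "length xs = length gs \<Longrightarrow> Suc i < length gs \<Longrightarrow>
    tensor (swap_adj i gs) (swap_adj i xs) = swap_adj i (tensor gs xs)"
  by (rule nth_equalityI) (auto simp: nth_tensor nth_list_update swap_adj_def)

lemma tensor_map_commute:
  "(\<And>g x. g \<in> set gs \<Longrightarrow> g (h x) = h (g x)) \<Longrightarrow> tensor gs (map h xs) = map h (tensor gs xs)"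
  unfolding tensor_def by (induction gs xs rule: list_induct2') auto

text \<open>\<open>koszul\<close> turns sums into products, so signs attached to single factors
  combine to the sign of the whole prefix that an operator of degree p passes.\<close>

lemma prod_list_koszul: "prod_list (map (\<lambda>q. koszul (p * q)) qs) = koszul (p * sum_list qs)"
  by (induction qs) (simp_all add: distrib_left koszul_add)

context hom_nambu_lie_superalgebra
begin

section \<open>Linear maps and homogeneous components of vectors\<close>

abbreviation lin :: "('v \<Rightarrow> 'v) \<Rightarrow> bool" where
  "lin \<equiv> Vector_Spaces.linear scale scale"

lemma lin_iff: "lin D \<longleftrightarrow> (\<forall>x y. D (x + y) = D x + D y) \<and> (\<forall>c x. D (scale c x) = scale c (D x))"
  using vector_space_axioms by (auto simp: Vector_Spaces.linear_iff)

lemma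
  assumes "lin D"
  shows lin_add: "D (x + y) = D x + D y"
    and lin_scale: "D (scale c x) = scale c (D x)"
    and lin_zero: "D 0 = 0"
    and lin_minus: "D (- x) = - D x"
    and lin_diff: "D (x - y) = D x - D y"
    and lin_sum: "D (sum f T) = (\<Sum>t\<in>T. D (f t))"
proof -
  interpret Vector_Spaces.linear scale scale D by fact
  show "D (x + y) = D x + D y" "D (scale c x) = scale c (D x)" "D 0 = 0" "D (- x) = - D x"
    "D (x - y) = D x - D y" "D (sum f T) = (\<Sum>t\<in>T. D (f t))"
    by (rule add scale zero neg diff sum)+
qed

lemmas lin_simps = lin_add lin_scale lin_zero lin_minus lin_diff

lemma lin_compose: "lin D \<Longrightarrow> lin E \<Longrightarrow> lin (D \<circ> E)"
  by (simp add: lin_iff)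

lemma lin_plus: "lin D \<Longrightarrow> lin E \<Longrightarrow> lin (D + E)"
  by (simp add: lin_iff algebra_simps)

lemma lin_zero_map: "lin 0"
  by (simp add: lin_iff)

lemma lin_smult: "lin D \<Longrightarrow> lin (\<lambda>x. scale c (D x))"
  by (simp add: lin_iff scale_right_distrib scale_left_commute)

lemma lin_id: "lin id"
  by (simp add: lin_iff)

lemma lin_funpow: "lin D \<Longrightarrow> lin (D ^^ k)"
  by (induction k) (auto intro: lin_compose lin_id)

lemma lin_alpha_pow: "lin (\<alpha> ^^ k)"
  by (intro lin_funpow linear_alpha)

lemma even_alpha_pow: "x \<in> V p \<Longrightarrow> (\<alpha> ^^ k) x \<in> V p"
  by (induction k) (auto intro: even_alpha)

lemma V_zero [simp]: "0 \<in> V p"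
  by (rule subspace_0[OF subspace_part])

lemma V_add: "x \<in> V p \<Longrightarrow> y \<in> V p \<Longrightarrow> x + y \<in> V p"
  by (rule subspace_add[OF subspace_part])

lemma V_diff: "x \<in> V p \<Longrightarrow> y \<in> V p \<Longrightarrow> x - y \<in> V p"
  by (rule subspace_diff[OF subspace_part])

lemma V_scale: "x \<in> V p \<Longrightarrow> scale c x \<in> V p"
  by (rule subspace_scale[OF subspace_part])

lemma V_disjoint: "x \<in> V p \<Longrightarrow> x \<in> V q \<Longrightarrow> p \<noteq> q \<Longrightarrow> x = 0"
  using parts_disjoint by (cases p; cases q) auto

text \<open>Two candidates for the component differ by an element of both \<open>V p\<close> and
  \<open>V (p + 1)\<close>, hence by 0. This gives access to the \<open>THE\<close> in the
  definition.\<close>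

lemma proj_eqI:
  assumes "a \<in> V p" "x - a \<in> V (p + 1)"
  shows "proj p x = a"
  unfolding proj_def
proof (rule the_equality)
  fix b assume b: "b \<in> V p \<and> x - b \<in> V (p + 1)"
  have "a - b \<in> V p" using assms b V_diff by blast
  moreover have "(x - b) - (x - a) \<in> V (p + 1)" using assms b V_diff by blast
  ultimately show "b = a" using V_disjoint[of "a - b" p "p + 1"] by (cases p) auto
qed (use assms in simp)

lemma proj_spec: "proj p x \<in> V p \<and> x - proj p x \<in> V (p + 1)"
proof -
  obtain a b where ab: "a \<in> V 0" "b \<in> V 1" "x = a + b" using decomp by blast
  show ?thesis
  proof (cases "p = 0")
    case True
    with ab proj_eqI[of a 0 x] show ?thesis by simp
  next
    case False
    with ab proj_eqI[of b 1 x] show ?thesis by simp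
  qed
qed

lemma proj_in [simp]: "proj p x \<in> V p"
  using proj_spec by blast

lemma proj_homogeneous: "x \<in> V q \<Longrightarrow> proj p x = (if p = q then x else 0)"
  by (cases p; cases q) (auto intro!: proj_eqI)

lemma proj_sum: "proj 0 x + proj 1 x = x"
proof -
  have "proj 1 x = x - proj 0 x"
    by (rule proj_eqI) (use proj_spec[of 0 x] in auto)
  then show ?thesis by simp
qed

lemma lin_proj: "lin (proj p)"
  unfolding lin_iff
proof (intro conjI allI)
  fix x y c
  show "proj p (x + y) = proj p x + proj p y"
    using V_add[of "x - proj p x" "p + 1" "y - proj p y"]
    by (intro proj_eqI) (auto simp: V_add proj_spec add_diff_add)
  show "proj p (scale c x) = scale c (proj p x)"
    using V_scale[of "x - proj p x" "p + 1" c]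
    by (intro proj_eqI) (auto simp: V_scale proj_spec scale_right_diff_distrib)
qed

section \<open>Homogeneous endomorphisms and components of endomorphisms\<close>

lemma End_partI: "lin D \<Longrightarrow> (\<And>q x. x \<in> V q \<Longrightarrow> D x \<in> V (p + q)) \<Longrightarrow> D \<in> End_part p"
  by (auto simp: End_part_def)

lemma End_part_lin: "D \<in> End_part p \<Longrightarrow> lin D"
  by (simp add: End_part_def)

lemma End_part_degree: "D \<in> End_part p \<Longrightarrow> x \<in> V q \<Longrightarrow> D x \<in> V (p + q)"
  by (auto simp: End_part_def)

text \<open>D shifts degrees by p, and p + (p + q) = q in characteristic 2, so the degree q part of
  the image comes from the degree p + q part of the argument.\<close>

lemma End_part_proj:
  assumes "D \<in> End_part p"
  shows "proj q (D x) = D (proj (p + q) x)"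
proof (rule proj_eqI)
  have e: "p + (p + q) = q" "p + (p + q + 1) = q + 1" by (simp_all add: add.assoc)
  show "D (proj (p + q) x) \<in> V q"
    using End_part_degree[OF assms proj_in[of "p + q" x]] by (simp only: e)
  show "D x - D (proj (p + q) x) \<in> V (q + 1)"
    using End_part_degree[OF assms, of "x - proj (p + q) x" "p + q + 1"] proj_spec[of "p + q" x]
    by (simp only: e lin_diff[OF End_part_lin[OF assms]])
qed

lemma alpha_End_part: "\<alpha> ^^ k \<in> End_part 0"
  by (rule End_partI) (auto intro: lin_alpha_pow even_alpha_pow)

lemma proj_alpha: "proj q (\<alpha> x) = \<alpha> (proj q x)"
  using End_part_proj[OF alpha_End_part[of 1], of q x] by simp

lemma lin_eqI:
  assumes "lin D" "lin E" "\<And>p x. x \<in> V p \<Longrightarrow> D x = E x"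
  shows "D = E"
proof
  fix x
  have "D (proj 0 x + proj 1 x) = E (proj 0 x + proj 1 x)"
    by (simp only: lin_add[OF assms(1)] lin_add[OF assms(2)] assms(3)[OF proj_in])
  then show "D x = E x" by (simp only: proj_sum)
qed

lemma End_part_zero: "0 \<in> End_part p"
  by (rule End_partI) (auto simp: lin_zero_map)

lemma End_part_add: "D \<in> End_part p \<Longrightarrow> E \<in> End_part p \<Longrightarrow> D + E \<in> End_part p"
  by (rule End_partI) (auto intro: lin_plus V_add End_part_lin End_part_degree)

lemma End_part_scale: "D \<in> End_part p \<Longrightarrow> End_scale c D \<in> End_part p"
  by (rule End_partI) (auto intro: lin_smult V_scale End_part_lin End_part_degree)

lemma End_part_compose: "D \<in> End_part p \<Longrightarrow> E \<in> End_part q \<Longrightarrow> D \<circ> E \<in> End_part (p + q)"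
  by (rule End_partI) (auto intro: lin_compose End_part_lin End_part_degree simp: add.assoc)

lemma End_part_disjoint: "D \<in> End_part p \<Longrightarrow> D \<in> End_part q \<Longrightarrow> p \<noteq> q \<Longrightarrow> D = 0"
  by (rule lin_eqI)
    (auto intro: End_part_lin lin_zero_map V_disjoint[OF End_part_degree[of D p] End_part_degree[of D q]])

text \<open>Of the four blocks of D with respect to the grading, \<open>End_proj p\<close> keeps the
  two that shift degrees by p.\<close>

lemma End_proj_in:
  assumes "lin D"
  shows "End_proj p D \<in> End_part p"
proof (rule End_partI)
  show "lin (End_proj p D)"
    using assms lin_proj unfolding lin_iff End_proj_def
    by (simp add: sum_bit algebra_simps)
  fix q x assume x: "x \<in> V q"
  show "End_proj p D x \<in> V (p + q)"
    unfolding End_proj_def sum_bit using x assms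
    by (cases q) (auto simp: proj_homogeneous lin_zero lin_zero[OF lin_proj])
qed

lemma lin_End_proj: "lin D \<Longrightarrow> lin (End_proj p D)"
  by (rule End_part_lin[OF End_proj_in])

lemma End_proj_homogeneous:
  assumes "D \<in> End_part q"
  shows "End_proj p D = (if p = q then D else 0)"
proof
  fix x
  have *: "proj (p + r) (D (proj r x)) = (if p = q then D (proj r x) else 0)" for r
    using proj_homogeneous[OF End_part_degree[OF assms proj_in[of r x]], of "p + r"] by simp
  have "End_proj p D x = (if p = q then D (proj 0 x) + D (proj 1 x) else 0)"
    unfolding End_proj_def sum_bit * by simp
  also have "\<dots> = (if p = q then D else 0) x"
    by (simp add: proj_sum lin_add[OF End_part_lin[OF assms], symmetric])
  finally show "End_proj p D x = (if p = q then D else 0) x" .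
qed

lemma End_proj_add: "End_proj p (D + E) = End_proj p D + End_proj p E"
  by (simp add: fun_eq_iff End_proj_def sum_bit lin_add[OF lin_proj] algebra_simps)

lemma End_proj_scale: "End_proj p (End_scale c D) = End_scale c (End_proj p D)"
  by (simp add: fun_eq_iff End_proj_def sum_bit lin_scale[OF lin_proj] algebra_simps)

lemma End_proj_zero: "End_proj p 0 = 0"
  by (simp add: fun_eq_iff End_proj_def sum_bit lin_zero[OF lin_proj])

lemma End_proj_sum:
  assumes "lin D"
  shows "End_proj 0 D + End_proj 1 D = D"
proof (rule lin_eqI)
  show "lin (End_proj 0 D + End_proj 1 D)"
    by (intro lin_plus lin_End_proj assms)
  fix p x assume "x \<in> V p"
  then show "(End_proj 0 D + End_proj 1 D) x = D x"
    using assms by (cases p)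
      (auto simp: End_proj_def sum_bit proj_homogeneous lin_zero lin_zero[OF lin_proj]
        proj_sum add.commute[of "proj 1 _"])
qed fact

subsection \<open>The supercommutator\<close>

lemma supercommutator_homogeneous:
  assumes "D \<in> End_part p" "E \<in> End_part q"
  shows "supercommutator D E = (\<lambda>x. D (E x) - scale (koszul (p * q)) (E (D x)))"
proof
  fix x
  show "supercommutator D E x = D (E x) - scale (koszul (p * q)) (E (D x))"
    using lin_zero[OF End_part_lin[OF assms(1)]] lin_zero[OF End_part_lin[OF assms(2)]]
    unfolding supercommutator_def sum_bit End_proj_homogeneous[OF assms(1)] End_proj_homogeneous[OF assms(2)]
    by (cases p; cases q) simp_all
qed

text \<open>The definition already sums over pairs of components, and each pair contributes the
  supercommutator of its two members. Statements about arbitrary endomorphisms thereby reduce to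
  homogeneous ones, where the sign is explicit.\<close>

lemma supercommutator_decompose:
  assumes "lin D" "lin E"
  shows "supercommutator D E =
    supercommutator (End_proj 0 D) (End_proj 0 E) + supercommutator (End_proj 0 D) (End_proj 1 E)
    + supercommutator (End_proj 1 D) (End_proj 0 E) + supercommutator (End_proj 1 D) (End_proj 1 E)"
  using assms
  by (simp add: fun_eq_iff supercommutator_homogeneous[OF End_proj_in End_proj_in])
    (simp add: supercommutator_def sum_bit algebra_simps)

lemma supercommutator_add_left:
  assumes "lin D" "lin D'" "lin E"
  shows "supercommutator (D + D') E = supercommutator D E + supercommutator D' E"
  unfolding fun_eq_iff supercommutator_def sum_bit End_proj_add
  by (simp add: lin_add[OF End_part_lin[OF End_proj_in[OF assms(3)]]] algebra_simps)

lemma supercommutator_add_right: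
  assumes "lin D" "lin E" "lin E'"
  shows "supercommutator D (E + E') = supercommutator D E + supercommutator D E'"
  unfolding fun_eq_iff supercommutator_def sum_bit End_proj_add
  by (simp add: lin_add[OF End_part_lin[OF End_proj_in[OF assms(1)]]] algebra_simps)

lemma supercommutator_scale_left:
  assumes "lin E"
  shows "supercommutator (End_scale c D) E = End_scale c (supercommutator D E)"
  unfolding fun_eq_iff supercommutator_def sum_bit End_proj_scale
  by (simp add: lin_scale[OF End_part_lin[OF End_proj_in[OF assms]]] algebra_simps)

lemma supercommutator_scale_right:
  assumes "lin D"
  shows "supercommutator D (End_scale c E) = End_scale c (supercommutator D E)"
  unfolding fun_eq_iff supercommutator_def sum_bit End_proj_scale
  by (simp add: lin_scale[OF End_part_lin[OF End_proj_in[OF assms]]] algebra_simps)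

lemma supercommutator_zero_left: "lin E \<Longrightarrow> supercommutator 0 E = 0"
  using lin_zero[OF End_part_lin[OF End_proj_in]]
  by (simp add: fun_eq_iff supercommutator_def End_proj_zero)

lemma supercommutator_zero_right: "lin D \<Longrightarrow> supercommutator D 0 = 0"
  using lin_zero[OF End_part_lin[OF End_proj_in]]
  by (simp add: fun_eq_iff supercommutator_def End_proj_zero)

lemma supercommutator_End_part:
  assumes "D \<in> End_part p" "E \<in> End_part q"
  shows "supercommutator D E \<in> End_part (p + q)"
proof -
  have "supercommutator D E = (D \<circ> E) + End_scale (- koszul (p * q)) (E \<circ> D)"
    by (simp add: supercommutator_homogeneous[OF assms] fun_eq_iff)
  then show ?thesis
    using End_part_compose[OF assms] End_part_compose[OF assms(2,1)]
    by (simp only: add.commute[of q p]) (intro End_part_add End_part_scale)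
qed

lemma lin_supercommutator:
  assumes "lin D" "lin E"
  shows "lin (supercommutator D E)"
  unfolding supercommutator_decompose[OF assms]
  by (intro lin_plus End_part_lin[OF supercommutator_End_part[OF End_proj_in End_proj_in]] assms)

lemma supercommutator_skew:
  assumes "D \<in> End_part p" "E \<in> End_part q"
  shows "supercommutator D E = - End_scale (koszul (p * q)) (supercommutator E D)"
  by (simp add: fun_eq_iff supercommutator_homogeneous[OF assms] supercommutator_homogeneous[OF assms(2,1)]
      scale_right_diff_distrib mult.commute[of q p])

text \<open>Composition is associative and \<open>koszul\<close> is multiplicative, so after
  expansion the terms cancel. Linearity is needed to move signs and differences through the outer
  maps.\<close>

lemma supercommutator_jacobi:
  assumes "D \<in> End_part p" "E \<in> End_part q" "F \<in> End_part r"
  shows "supercommutator D (supercommutator E F) = supercommutator (supercommutator D E) F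
    + End_scale (koszul (p * q)) (supercommutator E (supercommutator D F))"
  unfolding supercommutator_homogeneous[OF assms(1) supercommutator_End_part[OF assms(2,3)]]
    supercommutator_homogeneous[OF supercommutator_End_part[OF assms(1,2)] assms(3)]
    supercommutator_homogeneous[OF assms(2) supercommutator_End_part[OF assms(1,3)]]
  unfolding supercommutator_homogeneous[OF assms(1,2)] supercommutator_homogeneous[OF assms(2,3)]
    supercommutator_homogeneous[OF assms(1,3)]
  by (simp add: fun_eq_iff assms[THEN End_part_lin, THEN lin_diff] assms[THEN End_part_lin, THEN lin_scale]
      scale_right_diff_distrib distrib_left distrib_right koszul_add mult.commute[of q p] algebra_simps)

subsection \<open>Derivations\<close>

lemma Der_partD:
  assumes "D \<in> Der_part k p"
  shows "D \<in> End_part p" "D (\<alpha> x) = \<alpha> (D x)"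
    "\<lbrakk>length xs = n; homogeneous V xs ps\<rbrakk> \<Longrightarrow>
      D (br xs) = (\<Sum>i<n. scale (koszul (p * sum_list (take i ps)))
                           (br ((map (\<alpha> ^^ k) xs)[i := D (xs ! i)])))"
  using assms unfolding Der_part_def by (auto simp: fun_eq_iff)

lemma Der_part_lin: "D \<in> Der_part k p \<Longrightarrow> lin D"
  by (rule End_part_lin[OF Der_partD(1)])

lemma Der_part_alpha_pow: "D \<in> Der_part k p \<Longrightarrow> D ((\<alpha> ^^ l) x) = (\<alpha> ^^ l) (D x)"
  by (induction l) (simp_all add: Der_partD(2))

lemma br_zero: "\<lbrakk>length xs = n; i < n\<rbrakk> \<Longrightarrow> br (xs[i := 0]) = 0"
  using br_scale[of xs i 0 0] by simp

lemma Der_part_zero: "0 \<in> Der_part k p"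
  unfolding Der_part_def
  using End_part_zero lin_zero[OF linear_alpha] by (auto simp: fun_eq_iff br_zero)

lemma Der_part_add:
  assumes "D \<in> Der_part k p" "E \<in> Der_part k p"
  shows "D + E \<in> Der_part k p"
  unfolding Der_part_def
  using assms[THEN Der_partD(1)]
  by (auto simp: fun_eq_iff End_part_add assms[THEN Der_partD(2)] lin_add[OF linear_alpha]
      assms[THEN Der_partD(3)] br_add scale_right_distrib sum.distrib)

lemma Der_part_scale:
  assumes "D \<in> Der_part k p"
  shows "End_scale c D \<in> Der_part k p"
  unfolding Der_part_def
  using assms[THEN Der_partD(1)]
  by (auto simp: fun_eq_iff End_part_scale assms[THEN Der_partD(2)] lin_scale[OF linear_alpha]
      assms[THEN Der_partD(3)] br_scale scale_sum_right scale_left_commute intro!: sum.cong)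


text \<open>A map of degree q applied at position i changes the degree of that factor only, which is
  seen by exactly the prefixes reaching beyond i. This is the source of the additional sign in a
  composite of derivations.\<close>

lemma sum_list_take_update:
  assumes "i < length ps"
  shows "sum_list (take j (ps[i := q + ps ! i])) = sum_list (take j ps) + (if i < j then q else (0 :: bit))"
  using assms
proof (induction ps arbitrary: i j)
  case (Cons a ps)
  then show ?case
    by (cases i; cases j) (simp_all add: algebra_simps)
qed simp

lemma homogeneous_nth: "homogeneous V xs ps \<Longrightarrow> i < length xs \<Longrightarrow> xs ! i \<in> V (ps ! i)"
  by (simp add: list_all2_conv_all_nth)

lemma homogeneous_map_alpha: "homogeneous V xs ps \<Longrightarrow> homogeneous V (map (\<alpha> ^^ k) xs) ps"
  by (auto simp: list_all2_conv_all_nth intro: even_alpha_pow)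

lemma homogeneous_update:
  "homogeneous V xs ps \<Longrightarrow> x \<in> V p \<Longrightarrow> homogeneous V (xs[i := x]) (ps[i := p])"
  by (simp add: list_all2_update_cong)

text \<open>Here E acts at position i and afterwards D at position j. If i < j, then D passes a
  factor whose degree E has raised by q, whence the additional sign. The powers of \<alpha> are
  moved inside D and E so that the terms of both orders of composition can be matched.\<close>

lemma Der_part_compose:
  assumes D: "D \<in> Der_part k p" and E: "E \<in> Der_part l q"
    and xs: "length xs = n" "homogeneous V xs ps"
  shows "D (E (br xs)) = (\<Sum>i<n. \<Sum>j<n.
    scale (koszul (q * sum_list (take i ps)) * koszul (p * sum_list (take j ps)) *
        koszul (if i < j then p * q else 0))
      (br (if i = j then (map (\<alpha> ^^ (k + l)) xs)[i := D (E (xs ! i))]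
        else (map (\<alpha> ^^ (k + l)) xs)[i := E ((\<alpha> ^^ k) (xs ! i)), j := D ((\<alpha> ^^ l) (xs ! j))])))"
proof -
  have len: "length ps = n" using xs list_all2_lengthD by metis
  have *: "D (br ((map (\<alpha> ^^ l) xs)[i := E (xs ! i)])) = (\<Sum>j<n.
      scale (koszul (p * sum_list (take j ps)) * koszul (if i < j then p * q else 0))
      (br (if i = j then (map (\<alpha> ^^ (k + l)) xs)[i := D (E (xs ! i))]
        else (map (\<alpha> ^^ (k + l)) xs)[i := E ((\<alpha> ^^ k) (xs ! i)), j := D ((\<alpha> ^^ l) (xs ! j))])))"
    (is "D (br ?ys) = ?R") if i: "i < n" for i
  proof -
    have "E (xs ! i) \<in> V (q + ps ! i)"
      using End_part_degree[OF Der_partD(1)[OF E] homogeneous_nth[OF xs(2)]] i xs(1) by simp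
    then have "homogeneous V ?ys (ps[i := q + ps ! i])"
      by (intro homogeneous_update homogeneous_map_alpha xs)
    then have "D (br ?ys) = (\<Sum>j<n. scale (koszul (p * sum_list (take j (ps[i := q + ps ! i]))))
        (br ((map (\<alpha> ^^ k) ?ys)[j := D (?ys ! j)])))"
      using xs by (intro Der_partD(3)[OF D]) auto
    also have "\<dots> = ?R"
    proof (rule sum.cong[OF refl])
      fix j assume "j \<in> {..<n}"
      then have j: "j < n" by simp
      have c: "koszul (p * sum_list (take j (ps[i := q + ps ! i]))) =
          (koszul (p * sum_list (take j ps)) * koszul (if i < j then p * q else 0) :: 'k)"
        using i len by (simp add: sum_list_take_update distrib_left koszul_add)
      have "map (\<alpha> ^^ k) ?ys = (map (\<alpha> ^^ (k + l)) xs)[i := E ((\<alpha> ^^ k) (xs ! i))]"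
        by (simp add: map_update funpow_add Der_part_alpha_pow[OF E] comp_assoc)
      then have "(map (\<alpha> ^^ k) ?ys)[j := D (?ys ! j)] =
          (if i = j then (map (\<alpha> ^^ (k + l)) xs)[i := D (E (xs ! i))]
        else (map (\<alpha> ^^ (k + l)) xs)[i := E ((\<alpha> ^^ k) (xs ! i)), j := D ((\<alpha> ^^ l) (xs ! j))])"
        using i j xs(1) by simp
      then show "scale (koszul (p * sum_list (take j (ps[i := q + ps ! i]))))
          (br ((map (\<alpha> ^^ k) ?ys)[j := D (?ys ! j)])) =
        scale (koszul (p * sum_list (take j ps)) * koszul (if i < j then p * q else 0))
          (br (if i = j then (map (\<alpha> ^^ (k + l)) xs)[i := D (E (xs ! i))]
            else (map (\<alpha> ^^ (k + l)) xs)[i := E ((\<alpha> ^^ k) (xs ! i)), j := D ((\<alpha> ^^ l) (xs ! j))]))"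
        unfolding c by simp
    qed
    finally show ?thesis .
  qed
  show ?thesis
    unfolding Der_partD(3)[OF E xs] lin_sum[OF Der_part_lin[OF D]] lin_scale[OF Der_part_lin[OF D]]
    by (intro sum.cong refl) (simp add: * scale_sum_right mult.assoc)
qed

lemma supercommutator_Der_part:
  assumes D: "D \<in> Der_part k p" and E: "E \<in> Der_part l q"
  shows "supercommutator D E \<in> Der_part (k + l) (p + q)"
  unfolding Der_part_def mem_Collect_eq
proof (intro conjI allI impI)
  note sc = supercommutator_homogeneous[OF Der_partD(1)[OF D] Der_partD(1)[OF E]]
  show "supercommutator D E \<in> End_part (p + q)"
    by (intro supercommutator_End_part Der_partD(1)[OF D] Der_partD(1)[OF E])
  show "supercommutator D E \<circ> \<alpha> = \<alpha> \<circ> supercommutator D E"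
    by (simp add: sc fun_eq_iff Der_partD(2)[OF D] Der_partD(2)[OF E]
        lin_diff[OF linear_alpha] lin_scale[OF linear_alpha])
  fix xs ps assume "length xs = n \<and> homogeneous V xs ps"
  then have xs: "length xs = n" "homogeneous V xs ps" by auto
  let ?S = "\<lambda>i. sum_list (take i ps)" and ?M = "map (\<alpha> ^^ (k + l)) xs"
  let ?c = "\<lambda>i j. koszul (q * ?S i) * koszul (p * ?S j) * koszul (if i < j then p * q else 0) :: 'k"
  let ?c' = "\<lambda>i j. koszul (p * ?S i) * koszul (q * ?S j) * koszul (if i < j then q * p else 0) :: 'k"
  let ?B = "\<lambda>i j. br (if i = j then ?M[i := D (E (xs ! i))]
        else ?M[i := E ((\<alpha> ^^ k) (xs ! i)), j := D ((\<alpha> ^^ l) (xs ! j))])"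
  let ?B' = "\<lambda>i j. br (if i = j then ?M[i := E (D (xs ! i))]
        else ?M[i := D ((\<alpha> ^^ l) (xs ! i)), j := E ((\<alpha> ^^ k) (xs ! j))])"
  have DE: "D (E (br xs)) = (\<Sum>i<n. \<Sum>j<n. scale (?c i j) (?B i j))"
    by (rule Der_part_compose[OF D E xs])
  have "E (D (br xs)) = (\<Sum>i<n. \<Sum>j<n. scale (?c' i j) (?B' i j))"
    unfolding Der_part_compose[OF E D xs] add.commute[of l k] by (rule refl)
  \<comment> \<open>After this exchange E acts at i and D at j in both double sums.\<close>
  also have "\<dots> = (\<Sum>i<n. \<Sum>j<n. scale (?c' j i) (?B' j i))"
    by (rule sum.swap)
  finally have ED: "E (D (br xs)) = \<dots>" .
  have *: "scale (?c i j) (?B i j) - scale (koszul (p * q)) (scale (?c' j i) (?B' j i)) =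
      (if i = j then scale (koszul ((p + q) * ?S i)) (br (?M[i := supercommutator D E (xs ! i)])) else 0)"
    if i: "i < n" for i j
  proof (cases "i = j")
    case True
    have "br (?M[i := x - scale c y]) = br (?M[i := x]) - scale c (br (?M[i := y]))" for x y c
      using br_add[of ?M i x "scale (- c) y"] br_scale[of ?M i "- c" y] i xs(1) by simp
    with True show ?thesis
      by (simp add: sc koszul_add distrib_right scale_right_diff_distrib mult.commute mult.left_commute)
  next
    case False
    \<comment> \<open>Exactly one of i < j and j < i holds, so exactly one of the two coefficients
      contains the additional sign, and they differ by \<open>koszul (p * q)\<close>.\<close>
    then have "?c i j = koszul (p * q) * ?c' j i"
      by (cases i j rule: linorder_cases) (simp_all add: mult.commute[of q p] mult_ac)
    moreover have "?B i j = ?B' j i"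
      using False by (simp add: list_update_swap[of i j])
    ultimately show ?thesis using False by simp
  qed
  have "supercommutator D E (br xs) =
      (\<Sum>i<n. \<Sum>j<n. scale (?c i j) (?B i j) - scale (koszul (p * q)) (scale (?c' j i) (?B' j i)))"
    unfolding sc DE ED scale_sum_right sum_subtractf ..
  also have "\<dots> = (\<Sum>i<n. \<Sum>j<n.
      (if i = j then scale (koszul ((p + q) * ?S i)) (br (?M[i := supercommutator D E (xs ! i)])) else 0))"
    by (intro sum.cong refl *) simp
  finally show "supercommutator D E (br xs) =
      (\<Sum>i<n. scale (koszul ((p + q) * ?S i)) (br (?M[i := supercommutator D E (xs ! i)])))"
    by simp
qed

lemma Der_part_subset: "Der_part k p \<subseteq> Der k"
proof -
  interpret E: vector_space End_scale by (rule vector_space_End)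
  show ?thesis unfolding Der_def using E.span_superset by blast
qed

lemma Der_add: "D \<in> Der k \<Longrightarrow> E \<in> Der k \<Longrightarrow> D + E \<in> Der k"
  using vector_space_End unfolding Der_def
  by (simp add: module_iff_vector_space[symmetric] module.span_add)

lemma Der_scale: "D \<in> Der k \<Longrightarrow> End_scale c D \<in> Der k"
  using vector_space_End unfolding Der_def
  by (simp add: module_iff_vector_space[symmetric] module.span_scale[of End_scale])

text \<open>The condition on the right cuts out a subspace containing all homogeneous derivations,
  hence their span; conversely D is the sum of its two components. Membership in the span thus
  becomes a statement about homogeneous derivations.\<close>

lemma Der_iff: "D \<in> Der k \<longleftrightarrow> lin D \<and> (\<forall>p. End_proj p D \<in> Der_part k p)"
proof
  interpret E: vector_space End_scale by (rule vector_space_End)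
  assume "D \<in> Der k"
  then show "lin D \<and> (\<forall>p. End_proj p D \<in> Der_part k p)"
    unfolding Der_def
  proof (induction rule: E.span_induct)
    case base
    then show ?case
      by (auto simp: E.subspace_def End_proj_zero End_proj_add End_proj_scale lin_zero_map
          intro: lin_plus lin_smult Der_part_zero Der_part_add Der_part_scale)
  next
    case (step D)
    then show ?case
      by (auto simp: End_proj_homogeneous[OF Der_partD(1)] intro: Der_part_lin Der_part_zero)
  qed
next
  assume "lin D \<and> (\<forall>p. End_proj p D \<in> Der_part k p)"
  then show "D \<in> Der k"
    using Der_add[of "End_proj 0 D" k "End_proj 1 D"] Der_part_subset End_proj_sum by fastforce
qed

lemma Der_lin: "D \<in> Der k \<Longrightarrow> lin D"
  by (simp add: Der_iff)

lemma supercommutator_Der: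
  assumes "D \<in> Der k" "E \<in> Der l"
  shows "supercommutator D E \<in> Der (k + l)"
proof -
  have "supercommutator (End_proj p D) (End_proj q E) \<in> Der (k + l)" for p q
    using assms unfolding Der_iff[of D] Der_iff[of E]
    by (intro subsetD[OF Der_part_subset supercommutator_Der_part]) blast+
  then show ?thesis
    unfolding supercommutator_decompose[OF assms[THEN Der_lin]] by (intro Der_add)
qed

subsection \<open>The Lie superalgebra structure on the direct sum\<close>

lemma Der_zero: "0 \<in> Der k"
  using Der_part_subset Der_part_zero by blast

lemma Der_sum_closed:
  assumes "\<And>t. t \<in> T \<Longrightarrow> f t \<in> Der k"
  shows "sum f T \<in> Der k"
  using assms by (induction T rule: infinite_finite_induct) (auto intro: Der_zero Der_add)

lemma lin_sum_map:
  assumes "\<And>t. t \<in> T \<Longrightarrow> lin (f t)"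
  shows "lin (sum f T)"
  using assms by (induction T rule: infinite_finite_induct) (auto intro: lin_zero_map lin_plus)

lemma supercommutator_sum_left:
  assumes "\<And>t. t \<in> T \<Longrightarrow> lin (f t)" "lin E"
  shows "supercommutator (sum f T) E = (\<Sum>t\<in>T. supercommutator (f t) E)"
  using assms
  by (induction T rule: infinite_finite_induct)
    (simp_all add: supercommutator_zero_left supercommutator_add_left lin_sum_map)

lemma supercommutator_sum_right:
  assumes "\<And>t. t \<in> T \<Longrightarrow> lin (f t)" "lin D"
  shows "supercommutator D (sum f T) = (\<Sum>t\<in>T. supercommutator D (f t))"
  using assms
  by (induction T rule: infinite_finite_induct)
    (simp_all add: supercommutator_zero_right supercommutator_add_right lin_sum_map)

lemma Der_sum_lin: "D \<in> Der_sum \<Longrightarrow> lin (D k)"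
  by (auto simp: Der_sum_def intro: Der_lin)

lemma Der_sum_part_End: "D \<in> Der_sum_part p \<Longrightarrow> D k \<in> End_part p"
  by (simp add: Der_sum_part_def)

lemma Der_sum_part_lin: "D \<in> Der_sum_part p \<Longrightarrow> lin (D k)"
  by (rule End_part_lin[OF Der_sum_part_End])

text \<open>The support of a convolution lies in the sumset of the two supports.\<close>

lemma Der_bracket_finite:
  assumes "finite {k. D k \<noteq> 0}" "finite {k. E k \<noteq> 0}" "\<And>k. lin (D k)" "\<And>k. lin (E k)"
  shows "finite {k. Der_bracket D E k \<noteq> 0}"
proof (rule finite_subset)
  show "finite ((\<lambda>(i, j). i + j) ` ({k. D k \<noteq> 0} \<times> {k. E k \<noteq> 0}))"
    using assms(1,2) by (intro finite_imageI finite_cartesian_product)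
  show "{k. Der_bracket D E k \<noteq> 0} \<subseteq> (\<lambda>(i, j). i + j) ` ({k. D k \<noteq> 0} \<times> {k. E k \<noteq> 0})"
  proof
    fix m assume "m \<in> {k. Der_bracket D E k \<noteq> 0}"
    then have "(\<Sum>k\<le>m. supercommutator (D k) (E (m - k))) \<noteq> 0"
      by (simp only: Der_bracket_def mem_Collect_eq not_False_eq_True)
    then obtain k where k: "k \<le> m" "supercommutator (D k) (E (m - k)) \<noteq> 0"
      by (rule sum.not_neutral_contains_not_neutral) simp
    then have "D k \<noteq> 0" "E (m - k) \<noteq> 0"
      using supercommutator_zero_left[OF assms(4)] supercommutator_zero_right[OF assms(3)] by metis+
    with k(1) show "m \<in> (\<lambda>(i, j). i + j) ` ({k. D k \<noteq> 0} \<times> {k. E k \<noteq> 0})"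
      by (auto intro!: image_eqI[of _ _ "(k, m - k)"])
  qed
qed

lemma Der_bracket_closed:
  assumes "D \<in> Der_sum" "E \<in> Der_sum"
  shows "Der_bracket D E \<in> Der_sum"
proof -
  have "Der_bracket D E m \<in> Der m" for m
    unfolding Der_bracket_def
  proof (rule Der_sum_closed)
    fix k assume "k \<in> {..m}"
    then show "supercommutator (D k) (E (m - k)) \<in> Der m"
      using supercommutator_Der[of "D k" k "E (m - k)" "m - k"] assms by (simp add: Der_sum_def)
  qed
  then show ?thesis
    using Der_bracket_finite[of D E] assms Der_sum_lin by (simp add: Der_sum_def)
qed

lemma Der_bracket_degree:
  assumes "D \<in> Der_sum_part p" "E \<in> Der_sum_part q"
  shows "Der_bracket D E \<in> Der_sum_part (p + q)"
proof -
  have "Der_bracket D E m \<in> End_part (p + q)" for m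
  proof -
    have "(\<Sum>k\<in>T. supercommutator (D k) (E (m - k))) \<in> End_part (p + q)" for T :: "nat set"
      using assms[THEN Der_sum_part_End]
      by (induction T rule: infinite_finite_induct)
        (auto intro: End_part_zero End_part_add supercommutator_End_part)
    then show ?thesis by (simp only: Der_bracket_def)
  qed
  then show ?thesis
    using assms Der_bracket_closed by (simp add: Der_sum_part_def)
qed

lemma Der_bracket_skew:
  assumes "D \<in> Der_sum_part p" "E \<in> Der_sum_part q"
  shows "Der_bracket D E = - sum_scale (koszul (p * q)) (Der_bracket E D)"
proof
  fix m
  have "Der_bracket D E m = (\<Sum>k\<le>m. - End_scale (koszul (p * q)) (supercommutator (E (m - k)) (D k)))"
    unfolding Der_bracket_def
    by (intro sum.cong refl supercommutator_skew assms[THEN Der_sum_part_End])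
  \<comment> \<open>Reversing the summation turns the index pairs (m - k, k) into (k, m -
    k).\<close>
  also have "\<dots> = - (\<Sum>k\<le>m. End_scale (koszul (p * q)) (supercommutator (E k) (D (m - k))))"
    unfolding sum_negf
    by (subst sum.atLeastAtMost_rev[of _ 0 m, unfolded atLeast0AtMost]) simp
  also have "\<dots> = (- sum_scale (koszul (p * q)) (Der_bracket E D)) m"
  proof -
    interpret E: vector_space End_scale by (rule vector_space_End)
    show ?thesis by (simp add: Der_bracket_def fun_eq_iff E.scale_sum_right)
  qed
  finally show "Der_bracket D E m = (- sum_scale (koszul (p * q)) (Der_bracket E D)) m" .
qed

lemma Der_bracket_jacobi:
  assumes x: "x \<in> Der_sum_part p" and y: "y \<in> Der_sum_part q" and z: "z \<in> Der_sum_part r"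
  shows "Der_bracket x (Der_bracket y z) = Der_bracket (Der_bracket x y) z
    + sum_scale (koszul (p * q)) (Der_bracket y (Der_bracket x z))"
proof
  fix m
  note lin = x[THEN Der_sum_part_lin] y[THEN Der_sum_part_lin] z[THEN Der_sum_part_lin]
  interpret E: vector_space End_scale by (rule vector_space_End)
  \<comment> \<open>Stated for arbitrary sequences because it serves two orders: x, y, z and y, x,
    z.\<close>
  have right: "Der_bracket u (Der_bracket v w) m =
      (\<Sum>i\<le>m. \<Sum>j\<le>m - i. supercommutator (u i) (supercommutator (v j) (w (m - i - j))))"
    if "\<And>k. lin (u k)" "\<And>k. lin (v k)" "\<And>k. lin (w k)" for u v w
    unfolding Der_bracket_def
    by (intro sum.cong refl supercommutator_sum_right lin_supercommutator that)
  have left: "Der_bracket (Der_bracket x y) z m =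
      (\<Sum>a\<le>m. \<Sum>i\<le>a. supercommutator (supercommutator (x i) (y (a - i))) (z (m - a)))"
    unfolding Der_bracket_def
    by (intro sum.cong refl supercommutator_sum_left lin_supercommutator lin)
  have "Der_bracket x (Der_bracket y z) m = (\<Sum>i\<le>m. \<Sum>j\<le>m - i.
      supercommutator (supercommutator (x i) (y j)) (z (m - i - j))
      + End_scale (koszul (p * q)) (supercommutator (y j) (supercommutator (x i) (z (m - i - j)))))"
    unfolding right[OF lin]
    by (intro sum.cong refl supercommutator_jacobi[OF Der_sum_part_End[OF x] Der_sum_part_End[OF y]
        Der_sum_part_End[OF z]])
  also have "\<dots> = Der_bracket (Der_bracket x y) z m
      + End_scale (koszul (p * q)) (Der_bracket y (Der_bracket x z) m)"
    unfolding left right[OF lin(2,1,3)] sum.distrib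
      sum_triangle_assoc[of "\<lambda>i j l. supercommutator (supercommutator (x i) (y j)) (z l)" m]
      sum_triangle_swap[of "\<lambda>i j l. supercommutator (y j) (supercommutator (x i) (z l))" m]
      E.scale_sum_right ..
  finally show "Der_bracket x (Der_bracket y z) m = (Der_bracket (Der_bracket x y) z
    + sum_scale (koszul (p * q)) (Der_bracket y (Der_bracket x z))) m"
    by (simp add: fun_eq_iff)
qed

lemma Der_sum_add: "D \<in> Der_sum \<Longrightarrow> E \<in> Der_sum \<Longrightarrow> D + E \<in> Der_sum"
  unfolding Der_sum_def
  by (auto intro: Der_add finite_subset[of _ "{k. D k \<noteq> 0} \<union> {k. E k \<noteq> 0}"])

lemma Der_sum_scale: "D \<in> Der_sum \<Longrightarrow> sum_scale c D \<in> Der_sum"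
  unfolding Der_sum_def
  by (auto intro: Der_scale finite_subset[of _ "{k. D k \<noteq> 0}"] simp: fun_eq_iff)

lemma super_space_Der_sum: "super_space sum_scale Der_sum Der_sum_part"
proof -
  interpret S: vector_space sum_scale by (rule vector_space_sum)
  show ?thesis
  proof
    fix p
    show "S.subspace (Der_sum_part p)"
      unfolding S.subspace_def Der_sum_part_def
      by (auto simp: Der_sum_add Der_sum_scale End_part_add End_part_scale End_part_zero)
        (simp add: Der_sum_def Der_zero)
    have "D = 0" if "D \<in> Der_sum_part 0" "D \<in> Der_sum_part 1" for D
    proof
      show "D k = 0 k" for k
        using End_part_disjoint[OF Der_sum_part_End[OF that(1)] Der_sum_part_End[OF that(2)]] by simp
    qed
    moreover have "0 \<in> Der_sum_part p" for p
      by (simp add: Der_sum_part_def Der_sum_def Der_zero End_part_zero)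
    ultimately show "Der_sum_part 0 \<inter> Der_sum_part 1 = {0}" by blast
    show "Der_sum = {x + y |x y. x \<in> Der_sum_part 0 \<and> y \<in> Der_sum_part 1}"
    proof (intro equalityI subsetI)
      fix D assume D: "D \<in> Der_sum"
      \<comment> \<open>Components are taken entrywise; \<open>End_proj\<close> maps 0 to 0, which
        keeps the support finite.\<close>
      have "(\<lambda>k. End_proj p (D k)) \<in> Der_sum_part p" for p
      proof -
        have "{k. End_proj p (D k) \<noteq> 0} \<subseteq> {k. D k \<noteq> 0}"
          using End_proj_zero by fastforce
        moreover have "End_proj p (D k) \<in> Der k" for k
        proof -
          have "D k \<in> Der k" using D by (simp add: Der_sum_def)
          then show ?thesis using Der_part_subset Der_iff by blast
        qed
        ultimately show ?thesis
          using D Der_sum_lin[OF D]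
          by (auto simp: Der_sum_part_def Der_sum_def End_proj_in intro: finite_subset)
      qed
      moreover have "D = (\<lambda>k. End_proj 0 (D k)) + (\<lambda>k. End_proj 1 (D k))"
        using End_proj_sum Der_sum_lin[OF D] by (simp add: fun_eq_iff)
      ultimately show "D \<in> {x + y |x y. x \<in> Der_sum_part 0 \<and> y \<in> Der_sum_part 1}" by blast
    qed (auto simp: Der_sum_part_def Der_sum_add)
  qed
qed

lemma Der_bracket_add_left:
  assumes "D \<in> Der_sum" "D' \<in> Der_sum" "E \<in> Der_sum"
  shows "Der_bracket (D + D') E = Der_bracket D E + Der_bracket D' E"
proof
  show "Der_bracket (D + D') E m = (Der_bracket D E + Der_bracket D' E) m" for m
    unfolding plus_fun_apply[of "Der_bracket D E"] Der_bracket_def sum.distrib[symmetric]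
    unfolding plus_fun_apply[of D]
    by (intro sum.cong refl supercommutator_add_left Der_sum_lin assms)
qed

lemma Der_bracket_add_right:
  assumes "D \<in> Der_sum" "E \<in> Der_sum" "E' \<in> Der_sum"
  shows "Der_bracket D (E + E') = Der_bracket D E + Der_bracket D E'"
proof
  show "Der_bracket D (E + E') m = (Der_bracket D E + Der_bracket D E') m" for m
    unfolding plus_fun_apply[of "Der_bracket D E"] Der_bracket_def sum.distrib[symmetric]
    unfolding plus_fun_apply[of E]
    by (intro sum.cong refl supercommutator_add_right Der_sum_lin assms)
qed

lemma Der_bracket_scale:
  assumes "D \<in> Der_sum" "E \<in> Der_sum"
  shows "Der_bracket (sum_scale c D) E = sum_scale c (Der_bracket D E)"
    and "Der_bracket D (sum_scale c E) = sum_scale c (Der_bracket D E)"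
proof -
  interpret E: vector_space End_scale by (rule vector_space_End)
  show "Der_bracket (sum_scale c D) E = sum_scale c (Der_bracket D E)"
    unfolding fun_eq_iff[of "Der_bracket _ _"] Der_bracket_def E.scale_sum_right
    by (intro allI sum.cong refl supercommutator_scale_left Der_sum_lin assms)
  show "Der_bracket D (sum_scale c E) = sum_scale c (Der_bracket D E)"
    unfolding fun_eq_iff[of "Der_bracket _ _"] Der_bracket_def E.scale_sum_right
    by (intro allI sum.cong refl supercommutator_scale_right Der_sum_lin assms)
qed

lemma lie_superalgebra_Der_sum: "lie_superalgebra sum_scale Der_sum Der_sum_part Der_bracket"
  using super_space_Der_sum
  by (rule lie_superalgebra.intro, intro lie_superalgebra_axioms.intro)
    (rule Der_bracket_add_left Der_bracket_add_right Der_bracket_scale Der_bracket_degree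
      Der_bracket_skew Der_bracket_jacobi; assumption)+

subsection \<open>Relations in the exterior power\<close>

interpretation F: vector_space form_scale
  by (rule vector_space_form)

abbreviation relations :: "nat \<Rightarrow> ('v list \<Rightarrow>\<^sub>0 'k) set" where
  "relations m \<equiv> F.span (wedge_relators m)"

lemma relation_add:
  "length xs = m \<Longrightarrow> i < m \<Longrightarrow> wedge (xs[i := x + y]) - wedge (xs[i := x]) - wedge (xs[i := y]) \<in> relations m"
  by (rule F.span_base) (unfold wedge_relators_def, blast)

lemma relation_scale:
  "length xs = m \<Longrightarrow> i < m \<Longrightarrow> wedge (xs[i := scale c x]) - form_scale c (wedge (xs[i := x])) \<in> relations m"
  by (rule F.span_base) (unfold wedge_relators_def, blast)

lemma relation_skew:
  "length xs = m \<Longrightarrow> Suc i < m \<Longrightarrow> xs ! i \<in> V p \<Longrightarrow> xs ! Suc i \<in> V q \<Longrightarrow>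
    wedge xs + form_scale (koszul (p * q)) (wedge (swap_adj i xs)) \<in> relations m"
  by (rule F.span_base) (unfold wedge_relators_def, blast)

lemma wedge_relators_cases:
  assumes "f \<in> wedge_relators m"
  obtains (add) xs i x y where "length xs = m" "i < m"
      "f = wedge (xs[i := x + y]) - wedge (xs[i := x]) - wedge (xs[i := y])"
    | (scale) xs i c x where "length xs = m" "i < m"
      "f = wedge (xs[i := scale c x]) - form_scale c (wedge (xs[i := x]))"
    | (skew) xs i p q where "length xs = m" "Suc i < m" "xs ! i \<in> V p" "xs ! Suc i \<in> V q"
      "f = wedge xs + form_scale (koszul (p * q)) (wedge (swap_adj i xs))"
  using assms unfolding wedge_relators_def by (elim UnE CollectE exE conjE) (rule that, assumption+)+

subsection \<open>Linear extension from decomposable forms\<close>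

definition extend :: "('v list \<Rightarrow> 'v list \<Rightarrow>\<^sub>0 'k) \<Rightarrow> ('v list \<Rightarrow>\<^sub>0 'k) \<Rightarrow> 'v list \<Rightarrow>\<^sub>0 'k" where
  "extend \<phi> f = (\<Sum>xs\<in>Poly_Mapping.keys f. form_scale (Poly_Mapping.lookup f xs) (\<phi> xs))"

lemma form_alpha_extend: "form_alpha = extend (\<lambda>xs. wedge (map \<alpha> xs))"
  by (simp add: fun_eq_iff form_alpha_def extend_def)

lemma extend_superset:
  assumes "finite K" "Poly_Mapping.keys f \<subseteq> K"
  shows "extend \<phi> f = (\<Sum>xs\<in>K. form_scale (Poly_Mapping.lookup f xs) (\<phi> xs))"
  unfolding extend_def using assms by (intro sum.mono_neutral_left) (auto simp: in_keys_iff)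

lemma extend_add: "extend \<phi> (f + g) = extend \<phi> f + extend \<phi> g"
proof -
  let ?K = "Poly_Mapping.keys f \<union> Poly_Mapping.keys g"
  have "Poly_Mapping.keys (f + g) \<subseteq> ?K" by (rule Poly_Mapping.keys_add)
  then show ?thesis
    by (simp add: extend_superset[where K = ?K] lookup_add F.scale_left_distrib sum.distrib)
qed

lemma extend_scale: "extend \<phi> (form_scale c f) = form_scale c (extend \<phi> f)"
proof -
  have "Poly_Mapping.keys (form_scale c f) \<subseteq> Poly_Mapping.keys f" by (auto simp: in_keys_iff)
  then show ?thesis
    by (simp add: extend_superset[where K = "Poly_Mapping.keys f"] F.scale_sum_right)
qed

lemma extend_zero: "extend \<phi> 0 = 0"
  by (simp add: extend_def)

lemma extend_minus: "extend \<phi> (f - g) = extend \<phi> f - extend \<phi> g"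
  using extend_add[of \<phi> "f - g" g] by (simp add: algebra_simps)

lemma extend_sum: "extend \<phi> (sum f T) = (\<Sum>t\<in>T. extend \<phi> (f t))"
  by (induction T rule: infinite_finite_induct) (simp_all add: extend_zero extend_add)

lemma extend_wedge: "extend \<phi> (wedge xs) = \<phi> xs"
  by (simp add: extend_def)

text \<open>The relations are spanned by the relators and \<open>extend\<close> is linear. This is
  the criterion for a linear map on forms to descend to the exterior powers.\<close>

lemma extend_relations:
  assumes "f \<in> relations m" "\<And>r. r \<in> wedge_relators m \<Longrightarrow> extend \<phi> r \<in> relations m'"
  shows "extend \<phi> f \<in> relations m'"
  using assms(1)
proof (induction rule: F.span_induct)
  case base
  then show ?case
    by (auto simp: F.subspace_def extend_zero extend_add extend_scale F.span_zero F.span_add F.span_scale)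
qed (rule assms(2))

text \<open>The forms \<open>wedge xs\<close> are the basis of the free space and f is expanded in
  it. This is what makes \<open>forms_induct\<close> an instance of
  \<open>extend_induct\<close>.\<close>

lemma extend_id: "extend wedge f = f"
proof (rule poly_mapping_eqI)
  fix ys
  show "Poly_Mapping.lookup (extend wedge f) ys = Poly_Mapping.lookup f ys"
    by (simp add: extend_def lookup_sum lookup_single when_def in_keys_iff if_distrib[of "\<lambda>c. _ * c"] cong: if_cong)
qed

lemma subspace_forms: "F.subspace (forms m)"
  using keys_add by (fastforce simp: F.subspace_def forms_def in_keys_iff)

lemma wedge_in_forms: "length xs = m \<Longrightarrow> wedge xs \<in> forms m"
  by (simp add: forms_def)

lemma extend_induct:
  assumes "F.subspace {f. P f}" "\<And>xs. xs \<in> Poly_Mapping.keys f \<Longrightarrow> P (\<phi> xs)"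
  shows "P (extend \<phi> f)"
  using F.subspace_sum[OF assms(1), of "Poly_Mapping.keys f"
      "\<lambda>xs. form_scale (Poly_Mapping.lookup f xs) (\<phi> xs)"] F.subspace_scale[OF assms(1)] assms(2)
  by (simp add: extend_def)

lemma forms_induct:
  assumes "f \<in> forms m" "F.subspace {f. P f}" "\<And>xs. length xs = m \<Longrightarrow> P (wedge xs)"
  shows "P f"
  using extend_induct[of P f wedge] assms by (simp add: extend_id forms_def)

lemma extend_forms:
  assumes "f \<in> forms m" "\<And>xs. length xs = m \<Longrightarrow> \<phi> xs \<in> forms m'"
  shows "extend \<phi> f \<in> forms m'"
  by (rule extend_induct) (use assms subspace_forms in \<open>auto simp: forms_def\<close>)

subsection \<open>Sums of tensor products of linear maps\<close>

text \<open>The common shape of the projections to homogeneous components and of the action of a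
  derivation, so that compatibility with the relations and with \<alpha> is proved once. Signs have
  to be built into the factors.\<close>

definition tensor_sum :: "'i set \<Rightarrow> ('i \<Rightarrow> ('v \<Rightarrow> 'v) list) \<Rightarrow> ('v list \<Rightarrow>\<^sub>0 'k) \<Rightarrow> 'v list \<Rightarrow>\<^sub>0 'k" where
  "tensor_sum T G = extend (\<lambda>xs. \<Sum>t\<in>T. wedge (tensor (G t) xs))"

lemma tensor_sum_forms:
  assumes "f \<in> forms m" "\<And>t. t \<in> T \<Longrightarrow> length (G t) = m"
  shows "tensor_sum T G f \<in> forms m"
  unfolding tensor_sum_def
  by (intro extend_forms[OF assms(1)] F.subspace_sum[OF subspace_forms] wedge_in_forms)
    (simp add: assms(2))

text \<open>Exchanging adjacent factors may permute the summands, as recorded by \<open>\<tau>\<close>.\<close>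

lemma tensor_sum_relations:
  assumes f: "f \<in> relations m"
    and len: "\<And>t. t \<in> T \<Longrightarrow> length (G t) = m"
    and lin: "\<And>t g. t \<in> T \<Longrightarrow> g \<in> set (G t) \<Longrightarrow> lin g"
    and bij: "\<And>i. Suc i < m \<Longrightarrow> bij_betw (\<tau> i) T T"
    and skew: "\<And>t xs i p q. \<lbrakk>t \<in> T; length xs = m; Suc i < m; xs ! i \<in> V p; xs ! Suc i \<in> V q\<rbrakk> \<Longrightarrow>
      wedge (tensor (G t) xs)
        + form_scale (koszul (p * q)) (wedge (tensor (G (\<tau> i t)) (swap_adj i xs))) \<in> relations m"
  shows "tensor_sum T G f \<in> relations m"
  unfolding tensor_sum_def
proof (rule extend_relations[OF f])
  fix r assume "r \<in> wedge_relators m"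
  then show "extend (\<lambda>xs. \<Sum>t\<in>T. wedge (tensor (G t) xs)) r \<in> relations m"
  proof (cases rule: wedge_relators_cases)
    case (add xs i x y)
    show ?thesis
      unfolding add(3) extend_minus extend_wedge sum_subtractf[symmetric]
      using add(1,2) len lin
      by (intro F.span_sum) (simp add: tensor_update relation_add lin_add)
  next
    case (scale xs i c x)
    show ?thesis
      unfolding scale(3) extend_minus extend_wedge extend_scale F.scale_sum_right sum_subtractf[symmetric]
      using scale(1,2) len lin
      by (intro F.span_sum) (simp add: tensor_update relation_scale lin_scale)
  next
    case (skew xs i p q)
    \<comment> \<open>Reindexing by \<open>\<tau> i\<close> pairs every summand for
      \<open>xs\<close> with the summand for the exchanged list to which the hypothesis on skew
      relators applies.\<close>
    have "(\<Sum>t\<in>T. wedge (tensor (G t) (swap_adj i xs)) :: 'v list \<Rightarrow>\<^sub>0 'k) =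
        (\<Sum>t\<in>T. wedge (tensor (G (\<tau> i t)) (swap_adj i xs)))"
      by (rule sum.reindex_bij_betw[OF bij[OF skew(2)], symmetric])
    then show ?thesis
      unfolding skew(5) extend_add extend_wedge extend_scale
      by (simp add: F.scale_sum_right sum.distrib[symmetric])
        (intro F.span_sum assms(5) skew)
  qed
qed

text \<open>Factors that commute with \<alpha> can be exchanged with it entry by entry, so the two
  operators commute on forms themselves and not merely modulo relations.\<close>

lemma tensor_sum_alpha:
  assumes "f \<in> forms m" "\<And>t g x. t \<in> T \<Longrightarrow> g \<in> set (G t) \<Longrightarrow> g (\<alpha> x) = \<alpha> (g x)"
  shows "tensor_sum T G (form_alpha f) = form_alpha (tensor_sum T G f)"
  using assms(1)
proof (rule forms_induct)
  show "F.subspace {f. tensor_sum T G (form_alpha f) = form_alpha (tensor_sum T G f)}"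
    by (simp add: F.subspace_def tensor_sum_def form_alpha_extend extend_zero extend_add extend_scale)
  fix xs
  show "tensor_sum T G (form_alpha (wedge xs)) = form_alpha (tensor_sum T G (wedge xs))"
    by (simp add: tensor_sum_def form_alpha_extend extend_wedge extend_sum tensor_map_commute assms(2))
qed

lemma form_alpha_forms: "f \<in> forms m \<Longrightarrow> form_alpha f \<in> forms m"
  unfolding form_alpha_extend by (erule extend_forms) (simp add: wedge_in_forms)

text \<open>As \<alpha> is linear and even, it maps every relator to a relator of the same kind.
  This makes \<open>ext_alpha\<close> independent of representatives.\<close>

lemma form_alpha_relations:
  assumes "f \<in> relations m"
  shows "form_alpha f \<in> relations m"
proof -
  have "extend (\<lambda>xs. wedge (map \<alpha> xs)) f \<in> relations m"
    using assms
  proof (rule extend_relations)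
    fix r assume "r \<in> wedge_relators m"
    then show "extend (\<lambda>xs. wedge (map \<alpha> xs)) r \<in> relations m"
    proof (cases rule: wedge_relators_cases)
      case (add xs i x y)
      then show ?thesis
        by (simp add: extend_minus extend_wedge map_update lin_add[OF linear_alpha] relation_add)
    next
      case (scale xs i c x)
      then show ?thesis
        by (simp add: extend_minus extend_wedge extend_scale map_update lin_scale[OF linear_alpha]
            relation_scale)
    next
      case (skew xs i p q)
      then show ?thesis
        by (simp add: extend_add extend_wedge extend_scale map_swap_adj relation_skew even_alpha)
    qed
  qed
  then show ?thesis by (simp only: form_alpha_extend)
qed

subsection \<open>Homogeneous components of forms\<close>

definition degree_lists :: "nat \<Rightarrow> bit \<Rightarrow> bit list set" where
  "degree_lists m p = {qs. length qs = m \<and> sum_list qs = p}"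

definition form_proj :: "nat \<Rightarrow> bit \<Rightarrow> ('v list \<Rightarrow>\<^sub>0 'k) \<Rightarrow> 'v list \<Rightarrow>\<^sub>0 'k" where
  "form_proj m p = tensor_sum (degree_lists m p) (map proj)"

lemma finite_degree_lists [simp]: "finite (degree_lists m p)"
  using finite_lists_length_eq[of "UNIV :: bit set" m]
  unfolding degree_lists_def by (rule finite_subset[rotated]) (auto simp: UNIV_bit)

text \<open>A projection sends a homogeneous vector to itself or to 0, hence into the same part, so
  the skew relation holds in each summand with the original sign. Exchanging two factors exchanges
  two entries of the degree list, which preserves the total degree.\<close>

lemma form_proj_relations:
  assumes "f \<in> relations m"
  shows "form_proj m p f \<in> relations m"
  unfolding form_proj_def using assms
proof (rule tensor_sum_relations[where \<tau> = swap_adj])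
  fix i assume "Suc i < m"
  then show "bij_betw (swap_adj i) (degree_lists m p) (degree_lists m p)"
    by (intro bij_betw_byWitness[where f' = "swap_adj i"])
      (auto simp: degree_lists_def swap_adj_swap_adj sum_list_swap_adj)
next
  fix qs xs i r s
  assume *: "qs \<in> degree_lists m p" "length xs = m" "Suc i < m" "xs ! i \<in> V r" "xs ! Suc i \<in> V s"
  then have len: "length qs = m" by (simp add: degree_lists_def)
  have "proj (qs ! j) (xs ! j) \<in> V t" if "xs ! j \<in> V t" for j t
    using that by (simp add: proj_homogeneous)
  with * len show "wedge (tensor (map proj qs) xs) + form_scale (koszul (r * s))
      (wedge (tensor (map proj (swap_adj i qs)) (swap_adj i xs))) \<in> relations m"
    by (simp add: map_swap_adj tensor_swap_adj) (rule relation_skew; simp add: nth_tensor)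
qed (auto simp: degree_lists_def intro: lin_proj)

subsection \<open>The action of homogeneous maps on forms\<close>

text \<open>Applying \<open>sign_map d\<close> to all factors to the left of \<open>D\<close> produces the Koszul sign without
  reference to the degrees of the factors, so that the action is defined on arbitrary forms.\<close>

definition sign_map :: "bit \<Rightarrow> 'v \<Rightarrow> 'v" where
  "sign_map d x = scale (koszul (d * 0)) (proj 0 x) + scale (koszul (d * 1)) (proj 1 x)"

lemma sign_map_homogeneous: "x \<in> V q \<Longrightarrow> sign_map d x = scale (koszul (d * q)) x"
  by (cases q) (auto simp: sign_map_def proj_homogeneous)

lemma lin_sign_map: "lin (sign_map d)"
  by (auto simp: lin_iff sign_map_def lin_add[OF lin_proj] lin_scale[OF lin_proj] algebra_simps)

lemma sign_map_alpha: "sign_map d (\<alpha> x) = \<alpha> (sign_map d x)"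
  by (simp add: sign_map_def proj_alpha lin_add[OF linear_alpha] lin_scale[OF linear_alpha])

definition action_maps :: "nat \<Rightarrow> nat \<Rightarrow> bit \<Rightarrow> ('v \<Rightarrow> 'v) \<Rightarrow> nat \<Rightarrow> ('v \<Rightarrow> 'v) list" where
  "action_maps m l d D i =
    map (\<lambda>j. if j < i then (\<alpha> ^^ l) \<circ> sign_map d else if j = i then D else \<alpha> ^^ l) [0..<m]"

definition form_action :: "nat \<Rightarrow> nat \<Rightarrow> bit \<Rightarrow> ('v \<Rightarrow> 'v) \<Rightarrow> ('v list \<Rightarrow>\<^sub>0 'k) \<Rightarrow> 'v list \<Rightarrow>\<^sub>0 'k" where
  "form_action m l d D = tensor_sum {..<m} (action_maps m l d D)"

lemma length_action_maps [simp]: "length (action_maps m l d D i) = m"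
  by (simp add: action_maps_def)

lemma nth_action_maps: "j < m \<Longrightarrow> action_maps m l d D i ! j =
    (if j < i then (\<alpha> ^^ l) \<circ> sign_map d else if j = i then D else \<alpha> ^^ l)"
  by (simp add: action_maps_def)

lemma alpha_pow_commute: "(\<alpha> ^^ l) (\<alpha> x) = \<alpha> ((\<alpha> ^^ l) x)"
  by (simp add: funpow_swap1)

text \<open>The permutation of summands lets D follow the vector it acts on. If D sits at one of the
  exchanged positions, only one of the two summands has the sign for passing the neighbour, and this
  accounts for the difference between the degree of the vector and that of its image under
  D.\<close>

lemma form_action_skew:
  fixes l :: nat
  assumes D: "D \<in> End_part d"
    and xs: "length xs = m" "Suc i < m" "xs ! i \<in> V p" "xs ! Suc i \<in> V q" and t: "t < m"
  defines "G \<equiv> action_maps m l d D"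
  shows "wedge (tensor (G t) xs) + form_scale (koszul (p * q))
      (wedge (tensor (G (if t = i then Suc i else if t = Suc i then i else t)) (swap_adj i xs)))
    \<in> relations m"
proof -
  let ?A = "\<alpha> ^^ l"
  have nth: "tensor (G t) ys ! j = (if j < t then ?A (sign_map d (ys ! j)) else if j = t then D (ys ! j) else ?A (ys ! j))"
    if "j < m" "length ys = m" for t ys j
    using that by (simp add: G_def nth_tensor nth_action_maps)
  have [simp]: "length (G t) = m" for t
    by (simp add: G_def)
  have len: "length (tensor (G t) ys) = m" if "length ys = m" for t ys
    using that by simp
  have deg: "?A (xs ! i) \<in> V p" "?A (xs ! Suc i) \<in> V q" "D (xs ! i) \<in> V (d + p)"
    "D (xs ! Suc i) \<in> V (d + q)"
    using xs by (auto intro: even_alpha_pow End_part_degree[OF D])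
  have sgn: "?A (sign_map d (xs ! i)) = scale (koszul (d * p)) (?A (xs ! i))"
    "?A (sign_map d (xs ! Suc i)) = scale (koszul (d * q)) (?A (xs ! Suc i))"
    using xs by (simp_all add: sign_map_homogeneous lin_scale[OF lin_alpha_pow])
  consider (other) "t \<noteq> i" "t \<noteq> Suc i" | (first) "t = i" | (second) "t = Suc i" by blast
  then show ?thesis
  proof cases
    case other
    have "swap_adj i (G t) = G t"
      using other xs(2) by (intro nth_equalityI)
        (auto simp: G_def swap_adj_def nth_list_update nth_action_maps)
    then have "tensor (G t) (swap_adj i xs) = swap_adj i (tensor (G t) xs)"
      using tensor_swap_adj[of xs "G t" i] xs by (simp add: G_def)
    moreover have "tensor (G t) xs ! i \<in> V p" "tensor (G t) xs ! Suc i \<in> V q"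
      using other xs deg by (auto simp: nth sgn V_scale)
    ultimately show ?thesis
      using other xs len by (simp add: relation_skew)
  next
    case first
    let ?w = "tensor (G i) xs" and ?u = "tensor (G (Suc i)) (swap_adj i xs)"
    have "?u = (swap_adj i ?w)[i := scale (koszul (d * q)) (?A (xs ! Suc i))]"
      using xs by (intro nth_equalityI)
        (auto simp: nth len sgn swap_adj_def nth_list_update)
    \<comment> \<open>Writing the list as an update by the entry it already has puts it in the form
      required by \<open>relation_scale\<close>.\<close>
    moreover have "(swap_adj i ?w)[i := ?A (xs ! Suc i)] = swap_adj i ?w"
      using xs by (intro nth_equalityI)
        (auto simp: nth len swap_adj_def nth_list_update)
    ultimately have "wedge ?u - form_scale (koszul (d * q)) (wedge (swap_adj i ?w)) \<in> relations m"
      using relation_scale[of "swap_adj i ?w" m i "koszul (d * q)" "?A (xs ! Suc i)"] xs len by simp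
    then have "form_scale (koszul (p * q)) (wedge ?u - form_scale (koszul (d * q)) (wedge (swap_adj i ?w)))
        \<in> relations m"
      by (rule F.span_scale)
    moreover have "wedge ?w + form_scale (koszul ((d + p) * q)) (wedge (swap_adj i ?w)) \<in> relations m"
      using xs deg len by (intro relation_skew) (auto simp: nth)
    ultimately have "(wedge ?w + form_scale (koszul ((d + p) * q)) (wedge (swap_adj i ?w)))
        + form_scale (koszul (p * q)) (wedge ?u - form_scale (koszul (d * q)) (wedge (swap_adj i ?w)))
        \<in> relations m"
      by (rule F.span_add[rotated])
    then show ?thesis
      using first by (simp add: distrib_right koszul_add F.scale_right_diff_distrib mult.commute[of "koszul (d * q)"])
  next
    case second
    let ?w = "tensor (G (Suc i)) xs" and ?u = "tensor (G i) (swap_adj i xs)"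
    \<comment> \<open>Undoing the exchange gives a list that differs from \<open>?w\<close> only by
      a sign at position i.\<close>
    let ?v = "swap_adj i ?u"
    have "?w = ?v[i := scale (koszul (d * p)) (?A (xs ! i))]"
      using xs by (intro nth_equalityI)
        (auto simp: nth len sgn swap_adj_def nth_list_update)
    moreover have "?v[i := ?A (xs ! i)] = ?v"
      using xs by (intro nth_equalityI)
        (auto simp: nth len swap_adj_def nth_list_update)
    ultimately have "wedge ?w - form_scale (koszul (d * p)) (wedge ?v) \<in> relations m"
      using relation_scale[of ?v m i "koszul (d * p)" "?A (xs ! i)"] xs len by simp
    moreover have "wedge ?v + form_scale (koszul (p * (d + q))) (wedge (swap_adj i ?v)) \<in> relations m"
      using xs deg len by (intro relation_skew) (auto simp: nth swap_adj_def nth_list_update)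
    then have "form_scale (koszul (d * p)) (wedge ?v + form_scale (koszul (p * (d + q))) (wedge ?u))
        \<in> relations m"
      using xs len by (intro F.span_scale) (simp add: swap_adj_swap_adj)
    ultimately have "(wedge ?w - form_scale (koszul (d * p)) (wedge ?v))
        + form_scale (koszul (d * p)) (wedge ?v + form_scale (koszul (p * (d + q))) (wedge ?u))
        \<in> relations m"
      by (rule F.span_add)
    then show ?thesis
      using second by (simp add: distrib_left koszul_add F.scale_right_distrib mult.commute[of p d])
  qed
qed

lemma form_action_relations:
  assumes "f \<in> relations m" "D \<in> End_part d"
  shows "form_action m l d D f \<in> relations m"
  unfolding form_action_def using assms(1)
proof (rule tensor_sum_relations[where
      \<tau> = "\<lambda>i t. if t = i then Suc i else if t = Suc i then i else t"])
  fix i assume "Suc i < m"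
  then show "bij_betw (\<lambda>t. if t = i then Suc i else if t = Suc i then i else t) {..<m} {..<m}"
    by (intro bij_betw_byWitness[where f' = "\<lambda>t. if t = i then Suc i else if t = Suc i then i else t"])
      auto
next
  fix t g assume "t \<in> {..<m}" "g \<in> set (action_maps m l d D t)"
  then show "lin g"
    using End_part_lin[OF assms(2)]
    by (auto simp: action_maps_def intro: lin_compose lin_alpha_pow lin_sign_map split: if_splits)
qed (use form_action_skew[OF assms(2)] in auto)

lemma form_action_alpha:
  assumes "f \<in> forms m" "\<And>x. D (\<alpha> x) = \<alpha> (D x)"
  shows "form_action m l d D (form_alpha f) = form_alpha (form_action m l d D f)"
  unfolding form_action_def using assms(1)
  by (rule tensor_sum_alpha)
    (auto simp: action_maps_def assms(2) alpha_pow_commute sign_map_alpha split: if_splits)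

interpretation E: vector_space End_scale
  by (rule vector_space_End)

section \<open>Multilinear expansion of the bracket\<close>

text \<open>The prefix \<open>zs\<close> collects the entries already treated, so each induction
  step is linearity in the entry just behind it. The lemma takes the signs of a derivation action
  out of the bracket.\<close>

lemma br_scale_list:
  assumes "length cs = length xs" "length (zs @ xs @ ys) = n"
  shows "br (zs @ map2 scale cs xs @ ys) = scale (prod_list cs) (br (zs @ xs @ ys))"
  using assms
proof (induction cs xs arbitrary: zs rule: list_induct2)
  case (Cons c cs x xs)
  have "br (zs @ scale c x # map2 scale cs xs @ ys) = scale c (br (zs @ x # map2 scale cs xs @ ys))"
    using br_scale[of "zs @ x # map2 scale cs xs @ ys" "length zs" c x] Cons.hyps Cons.prems
    by simp
  also have "br (zs @ x # map2 scale cs xs @ ys) = scale (prod_list cs) (br (zs @ x # xs @ ys))"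
    using Cons.IH[of "zs @ [x]"] Cons.prems by simp
  finally show ?case by simp
qed simp

text \<open>Each factor is the sum of its two components and the bracket is additive in each slot;
  \<open>zs\<close> collects the factors already projected.\<close>

lemma br_expand:
  assumes "length (zs @ xs @ ys) = n"
  shows "(\<Sum>qs | length qs = length xs. br (zs @ tensor (map proj qs) xs @ ys)) = br (zs @ xs @ ys)"
  using assms
proof (induction xs arbitrary: zs)
  case Nil
  then show ?case by (simp add: tensor_def)
next
  case (Cons x xs)
  have "(\<Sum>qs | length qs = length (x # xs). br (zs @ tensor (map proj qs) (x # xs) @ ys)) =
      (\<Sum>(q, qs) \<in> UNIV \<times> {qs. length qs = length xs}. br (zs @ tensor (map proj (q # qs)) (x # xs) @ ys))"
    by (rule sum.reindex_bij_witness[where j = "\<lambda>qs. (hd qs, tl qs)" and i = "\<lambda>(q, qs). q # qs"])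
      (auto simp: length_Suc_conv)
  also have "\<dots> = (\<Sum>q\<in>UNIV. \<Sum>qs | length qs = length xs. br (zs @ tensor (map proj (q # qs)) (x # xs) @ ys))"
    by (rule sum.cartesian_product[symmetric])
  also have "\<dots> = (\<Sum>q\<in>UNIV. br ((zs @ [proj q x]) @ xs @ ys))"
  proof (rule sum.cong[OF refl])
    fix q
    show "(\<Sum>qs | length qs = length xs. br (zs @ tensor (map proj (q # qs)) (x # xs) @ ys)) =
        br ((zs @ [proj q x]) @ xs @ ys)"
      using Cons.IH[of "zs @ [proj q x]"] Cons.prems by (simp add: tensor_def)
  qed
  also have "\<dots> = br (zs @ (x # xs) @ ys)"
    using br_add[of "zs @ x # xs @ ys" "length zs" "proj 0 x" "proj 1 x"] Cons.prems
    by (simp add: sum_bit proj_sum)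
  finally show ?case .
qed

subsection \<open>Homogeneous and fixed forms\<close>

text \<open>Given by generators rather than as the image of \<open>form_proj\<close>, so that
  identities linear in the form need checking only on wedges of homogeneous vectors, where the
  axioms apply.\<close>

definition homogeneous_forms :: "bit \<Rightarrow> ('v list \<Rightarrow>\<^sub>0 'k) set" where
  "homogeneous_forms q =
    F.span {wedge xs |xs qs. length xs = n - 1 \<and> homogeneous V xs qs \<and> sum_list qs = q}"

text \<open>Representatives of the fixed points of \<open>ext_alpha\<close>, as
  \<open>ext_alpha_class_iff\<close> shows; the form itself is fixed only modulo relations.\<close>

definition fixed_forms :: "('v list \<Rightarrow>\<^sub>0 'k) set" where
  "fixed_forms = {f \<in> forms (n - 1). form_alpha f - f \<in> relations (n - 1)}"

lemma homogeneous_forms_induct [consumes 1, case_names subspace wedge]: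
  assumes "f \<in> homogeneous_forms q" "F.subspace {f. P f}"
    and "\<And>xs qs. \<lbrakk>length xs = n - 1; homogeneous V xs qs; sum_list qs = q\<rbrakk> \<Longrightarrow> P (wedge xs)"
  shows "P f"
  using assms(1) unfolding homogeneous_forms_def
  by (rule F.span_induct) (use assms in auto)

lemma homogeneous_forms_subset: "f \<in> homogeneous_forms q \<Longrightarrow> f \<in> forms (n - 1)"
  by (erule homogeneous_forms_induct) (auto simp: subspace_forms wedge_in_forms)

lemma form_proj_homogeneous:
  assumes "f \<in> forms (n - 1)"
  shows "form_proj (n - 1) q f \<in> homogeneous_forms q"
  using assms
proof (rule forms_induct)
  have sub: "F.subspace (homogeneous_forms q)"
    unfolding homogeneous_forms_def by (rule F.subspace_span)
  then show "F.subspace {f. form_proj (n - 1) q f \<in> homogeneous_forms q}"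
    by (auto simp: form_proj_def tensor_sum_def F.subspace_def extend_zero extend_add extend_scale)
  fix xs :: "'v list" assume xs: "length xs = n - 1"
  have "wedge (tensor (map proj qs) xs) \<in> homogeneous_forms q" if "qs \<in> degree_lists (n - 1) q" for qs
  proof -
    have "homogeneous V (tensor (map proj qs) xs) qs"
      using that xs by (auto simp: degree_lists_def list_all2_conv_all_nth nth_tensor)
    then show ?thesis
      unfolding homogeneous_forms_def using that xs
      by (intro F.span_base) (auto simp: degree_lists_def)
  qed
  then show "form_proj (n - 1) q (wedge xs) \<in> homogeneous_forms q"
    unfolding form_proj_def tensor_sum_def extend_wedge by (intro F.subspace_sum[OF sub])
qed

text \<open>The projection is linear, commutes with \<open>form_alpha\<close> and preserves
  relations, so it can be applied to the relation \<open>form_alpha f - f\<close>. The next lemma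
  argues in the same way for the action of D.\<close>

lemma form_proj_fixed:
  assumes "f \<in> fixed_forms"
  shows "form_proj (n - 1) q f \<in> fixed_forms"
proof -
  have f: "f \<in> forms (n - 1)" "form_alpha f - f \<in> relations (n - 1)"
    using assms by (auto simp: fixed_forms_def)
  have "form_alpha (form_proj (n - 1) q f) = form_proj (n - 1) q (form_alpha f)"
    unfolding form_proj_def by (rule tensor_sum_alpha[OF f(1), symmetric]) (auto simp: proj_alpha)
  then have "form_alpha (form_proj (n - 1) q f) - form_proj (n - 1) q f
      = form_proj (n - 1) q (form_alpha f - f)"
    by (simp add: form_proj_def tensor_sum_def extend_minus)
  then show ?thesis
    using form_proj_relations[OF f(2)] homogeneous_forms_subset[OF form_proj_homogeneous[OF f(1)]]
    by (simp add: fixed_forms_def)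
qed

lemma form_action_fixed:
  assumes "f \<in> fixed_forms" "D \<in> End_part d" "\<And>x. D (\<alpha> x) = \<alpha> (D x)"
  shows "form_action (n - 1) l d D f \<in> fixed_forms"
proof -
  have f: "f \<in> forms (n - 1)" "form_alpha f - f \<in> relations (n - 1)"
    using assms by (auto simp: fixed_forms_def)
  have "form_alpha (form_action (n - 1) l d D f) - form_action (n - 1) l d D f
      = form_action (n - 1) l d D (form_alpha f - f)"
    unfolding form_action_alpha[OF f(1), where D = D, OF assms(3), symmetric]
    by (simp add: form_action_def tensor_sum_def extend_minus)
  moreover have "form_action (n - 1) l d D f \<in> forms (n - 1)"
    unfolding form_action_def by (rule tensor_sum_forms[OF f(1)]) simp
  ultimately show ?thesis
    using form_action_relations[OF f(2) assms(2)] by (simp add: fixed_forms_def)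
qed

lemma form_alpha_pow_linear:
  "(form_alpha ^^ l) 0 = 0"
  "(form_alpha ^^ l) (f + g) = (form_alpha ^^ l) f + (form_alpha ^^ l) g"
  "(form_alpha ^^ l) (form_scale c f) = form_scale c ((form_alpha ^^ l) f)"
  by (induction l) (simp_all add: form_alpha_extend extend_zero extend_add extend_scale)

lemma form_alpha_wedge: "form_alpha (wedge xs) = wedge (map \<alpha> xs)"
  by (simp add: form_alpha_extend extend_wedge)

lemma form_alpha_pow_wedge: "(form_alpha ^^ l) (wedge xs) = wedge (map (\<alpha> ^^ l) xs)"
  by (induction l) (simp_all add: form_alpha_wedge o_def)

text \<open>A telescoping sum. It is needed because an \<alpha>^l-derivation acting on the last slot
  of a bracket applies \<alpha>^l to the other factors.\<close>

lemma form_alpha_pow_fixed: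
  assumes "f \<in> fixed_forms"
  shows "(form_alpha ^^ l) f - f \<in> relations (n - 1)"
proof (induction l)
  case (Suc l)
  have "form_alpha ((form_alpha ^^ l) f - f) + (form_alpha f - f) \<in> relations (n - 1)"
    using assms Suc by (intro F.span_add form_alpha_relations) (auto simp: fixed_forms_def)
  then show ?case by (simp add: form_alpha_extend extend_minus)
qed (simp add: F.span_zero)

subsection \<open>Inner derivations\<close>

lemma form_ad_cong:
  assumes "0 < n" "f - g \<in> relations (n - 1)"
  shows "form_ad k f = form_ad k g"
proof
  fix y
  show "form_ad k f y = form_ad k g y"
    using form_ad_relator[OF assms(2)] assms(1) by (simp add: form_ad_minus Suc_le_eq)
qed

lemma form_ad_zero: "form_ad k 0 y = 0"
  by (simp add: form_ad_def)

lemma form_ad_sum: "form_ad k (sum f T) y = (\<Sum>t\<in>T. form_ad k (f t) y)"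
  by (induction T rule: infinite_finite_induct) (simp_all add: form_ad_zero form_ad_add)

lemma form_ad_lin:
  assumes "0 < n" "f \<in> forms (n - 1)"
  shows "lin (form_ad k f)"
  using assms(2)
proof (rule forms_induct)
  show "F.subspace {f. lin (form_ad k f)}"
    by (auto simp: F.subspace_def lin_iff form_ad_zero form_ad_add form_ad_scale
        scale_right_distrib scale_left_commute)
  fix xs :: "'v list" assume xs: "length xs = n - 1"
  have "br (xs @ [x + y]) = br (xs @ [x]) + br (xs @ [y])" for x y
    using br_add[of "xs @ [x]" "n - 1" x y] xs assms(1) by (simp add: list_update_append)
  moreover have "br (xs @ [scale c x]) = scale c (br (xs @ [x]))" for c x
    using br_scale[of "xs @ [x]" "n - 1" c x] xs assms(1) by (simp add: list_update_append)
  ultimately show "lin (form_ad k (wedge xs))"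
    by (simp add: lin_iff form_ad_wedge lin_add[OF lin_alpha_pow] lin_scale[OF lin_alpha_pow])
qed

lemma homogeneous_snoc:
  "homogeneous V xs qs \<Longrightarrow> y \<in> V r \<Longrightarrow> homogeneous V (xs @ [y]) (qs @ [r])"
  by (simp add: list_all2_appendI)

lemma form_ad_End_part:
  assumes n: "0 < n" and f: "f \<in> homogeneous_forms q"
  shows "form_ad k f \<in> End_part q"
proof (rule End_partI)
  show "lin (form_ad k f)" by (rule form_ad_lin[OF n homogeneous_forms_subset[OF f]])
  fix r y assume y: "y \<in> V r"
  show "form_ad k f y \<in> V (q + r)"
    using f
  proof (induction rule: homogeneous_forms_induct)
    case subspace
    show ?case by (auto simp: F.subspace_def form_ad_zero form_ad_add form_ad_scale V_add V_scale)
  next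
    case (wedge xs qs)
    show ?case
      using br_degree[OF _ homogeneous_snoc[OF wedge(2) even_alpha_pow[OF y, of k]]] wedge n
      by (simp add: form_ad_wedge)
  qed
qed

text \<open>In the free space of forms the two components need not add up to f; they do so modulo
  multilinearity. The identity is therefore stated after \<open>form_ad\<close>, where
  \<open>br_expand\<close> yields it.\<close>

lemma form_ad_proj_sum:
  assumes n: "0 < n" and f: "f \<in> forms (n - 1)"
  shows "form_ad k (form_proj (n - 1) 0 f) + form_ad k (form_proj (n - 1) 1 f) = form_ad k f"
  using f
proof (rule forms_induct)
  let ?P = "\<lambda>f. form_ad k (form_proj (n - 1) 0 f) + form_ad k (form_proj (n - 1) 1 f) = form_ad k f"
  show "F.subspace {f. ?P f}"
    by (simp add: F.subspace_def fun_eq_iff form_proj_def tensor_sum_def extend_zero extend_add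
        extend_scale form_ad_zero form_ad_add form_ad_scale scale_right_distrib[symmetric])
      (simp add: algebra_simps)
  fix xs :: "'v list" assume xs: "length xs = n - 1"
  show "?P (wedge xs)"
  proof
    fix y
    let ?h = "\<lambda>qs. br (tensor (map proj qs) xs @ [(\<alpha> ^^ k) y])"
    have "sum ?h (degree_lists (n - 1) 0) + sum ?h (degree_lists (n - 1) 1)
        = sum ?h (degree_lists (n - 1) 0 \<union> degree_lists (n - 1) 1)"
      by (rule sum.union_disjoint[symmetric, OF finite_degree_lists finite_degree_lists])
        (auto simp: degree_lists_def)
    also have "degree_lists (n - 1) 0 \<union> degree_lists (n - 1) 1 = {qs. length qs = length xs}"
      using xs by (auto simp: degree_lists_def)
    also have "sum ?h \<dots> = br (xs @ [(\<alpha> ^^ k) y])"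
      using br_expand[of "[]" xs "[(\<alpha> ^^ k) y]"] xs n by simp
    finally show "(form_ad k (form_proj (n - 1) 0 (wedge xs))
        + form_ad k (form_proj (n - 1) 1 (wedge xs))) y = form_ad k (wedge xs) y"
      by (simp add: form_proj_def tensor_sum_def extend_wedge form_ad_sum form_ad_wedge)
  qed
qed

lemma form_ad_alpha:
  assumes n: "0 < n" and f: "f \<in> homogeneous_forms q" and y: "y \<in> V r"
  shows "\<alpha> (form_ad k f y) = form_ad k (form_alpha f) (\<alpha> y)"
  using f
proof (induction rule: homogeneous_forms_induct)
  case subspace
  show ?case
    by (simp add: F.subspace_def form_alpha_extend extend_zero extend_add extend_scale form_ad_zero
        form_ad_add form_ad_scale lin_simps[OF linear_alpha])
next
  case (wedge xs qs)
  show ?case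
    using alpha_br[OF _ homogeneous_snoc[OF wedge(2) even_alpha_pow[OF y, of k]]] wedge(1) n
    by (simp add: form_alpha_wedge form_ad_wedge alpha_pow_commute)
qed

lemma br_sum_scale:
  assumes "length xs = n" "i < n"
  shows "br (xs[i := 0]) = 0" "br (xs[i := x + y]) = br (xs[i := x]) + br (xs[i := y])"
    "br (xs[i := scale c x]) = scale c (br (xs[i := x]))"
  using assms br_zero br_add br_scale by auto

text \<open>This is the Hom-Nambu identity with \<alpha>^k applied to all entries of
  \<open>ys\<close>. The identity applies \<alpha> once more to the entries not acted on, whence
  \<open>Suc k\<close>, and applies \<alpha> to the form on the left.\<close>

lemma form_ad_br:
  assumes n: "0 < n" and f: "f \<in> homogeneous_forms q" and ys: "length ys = n" "homogeneous V ys rs"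
  shows "form_ad k (form_alpha f) (br ys) = (\<Sum>i<n. scale (koszul (q * sum_list (take i rs)))
    (br ((map (\<alpha> ^^ Suc k) ys)[i := form_ad k f (ys ! i)])))"
  using f
proof (induction rule: homogeneous_forms_induct)
  case subspace
  show ?case
    unfolding F.subspace_def using ys
    by (simp add: form_alpha_extend extend_zero extend_add extend_scale form_ad_zero form_ad_add
        form_ad_scale br_sum_scale scale_right_distrib sum.distrib scale_sum_right mult.commute)
next
  case (wedge xs qs)
  \<comment> \<open>Multiplicativity moves the power of \<alpha> in the last slot inside the inner
    bracket.\<close>
  have "(\<alpha> ^^ l) (br ys) = br (map (\<alpha> ^^ l) ys)" for l
  proof (induction l)
    case (Suc l)
    then show ?case
      using alpha_br[OF _ homogeneous_map_alpha[OF ys(2), of l]] ys(1) by (simp add: o_def)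
  qed simp
  then show ?case
    using br_hom_nambu[OF wedge(1,2) _ homogeneous_map_alpha[OF ys(2), of k]] ys(1) wedge(3)
    by (simp add: form_alpha_wedge form_ad_wedge o_def)
qed

lemma form_ad_Der_part:
  assumes n: "0 < n" and f: "f \<in> homogeneous_forms q" "f \<in> fixed_forms"
  shows "form_ad k f \<in> Der_part (Suc k) q"
  unfolding Der_part_def mem_Collect_eq
proof (intro conjI allI impI)
  show End: "form_ad k f \<in> End_part q" by (rule form_ad_End_part[OF n f(1)])
  \<comment> \<open>Invariance of the form removes \<open>form_alpha\<close> from
    \<open>form_ad_alpha\<close> and \<open>form_ad_br\<close>, which then become the two conditions
    on a derivation.\<close>
  have fixed: "form_ad k (form_alpha f) = form_ad k f"
    using form_ad_cong[OF n] f(2) by (simp add: fixed_forms_def)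
  show "form_ad k f \<circ> \<alpha> = \<alpha> \<circ> form_ad k f"
  proof (rule lin_eqI)
    show "lin (form_ad k f \<circ> \<alpha>)" "lin (\<alpha> \<circ> form_ad k f)"
      by (intro lin_compose linear_alpha End_part_lin[OF End])+
    show "(form_ad k f \<circ> \<alpha>) x = (\<alpha> \<circ> form_ad k f) x" if "x \<in> V r" for r x
      using form_ad_alpha[OF n f(1) that] by (simp only: fixed o_apply)
  qed
  fix ys rs assume "length ys = n \<and> homogeneous V ys rs"
  then show "form_ad k f (br ys) = (\<Sum>i<n. scale (koszul (q * sum_list (take i rs)))
      (br ((map (\<alpha> ^^ Suc k) ys)[i := form_ad k f (ys ! i)])))"
    using form_ad_br[OF n f(1), of ys rs k] by (simp only: fixed)
qed

text \<open>On homogeneous factors the sign maps are scalars; multilinearity takes them out of the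
  bracket, and their product is the Koszul sign of the prefix before D.\<close>

lemma form_action_wedge:
  assumes D: "D \<in> End_part p" and xs: "length xs = n - 1" "homogeneous V xs qs" and n: "0 < n"
  shows "form_ad k (form_action (n - 1) l p D (wedge xs)) y =
    (\<Sum>i<n - 1. scale (koszul (p * sum_list (take i qs)))
      (br ((map (\<alpha> ^^ l) xs)[i := D (xs ! i)] @ [(\<alpha> ^^ k) y])))"
proof -
  have len: "length qs = n - 1" using xs list_all2_lengthD by metis
  have "br (tensor (action_maps (n - 1) l p D i) xs @ [(\<alpha> ^^ k) y]) =
      scale (koszul (p * sum_list (take i qs))) (br ((map (\<alpha> ^^ l) xs)[i := D (xs ! i)] @ [(\<alpha> ^^ k) y]))"
    if i: "i < n - 1" for i
  proof -
    let ?Z = "(map (\<alpha> ^^ l) xs)[i := D (xs ! i)]"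
    let ?cs = "map (\<lambda>q. koszul (p * q)) (take i qs)"
    \<comment> \<open>Only the factors in front of position i carry a sign; \<open>?Z\<close> is
      split there.\<close>
    have "tensor (action_maps (n - 1) l p D i) xs = map2 scale ?cs (take i ?Z) @ drop i ?Z"
    proof (rule nth_equalityI)
      fix j assume "j < length (tensor (action_maps (n - 1) l p D i) xs)"
      then have j: "j < n - 1" using xs by simp
      have "sign_map p (xs ! j) = scale (koszul (p * qs ! j)) (xs ! j)"
        using homogeneous_nth[OF xs(2)] j xs(1) by (simp add: sign_map_homogeneous)
      then show "tensor (action_maps (n - 1) l p D i) xs ! j =
          (map2 scale ?cs (take i ?Z) @ drop i ?Z) ! j"
        using i j xs(1) len
        by (auto simp: nth_tensor nth_action_maps nth_append lin_scale[OF lin_alpha_pow])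
    qed (use i xs len in simp)
    moreover have "br ([] @ map2 scale ?cs (take i ?Z) @ drop i ?Z @ [(\<alpha> ^^ k) y]) =
        scale (prod_list ?cs) (br ([] @ take i ?Z @ drop i ?Z @ [(\<alpha> ^^ k) y]))"
      by (rule br_scale_list) (use i xs(1) len n in simp_all)
    ultimately show ?thesis
      by (simp only: append_Nil append_assoc[symmetric] append_take_drop_id prod_list_koszul)
  qed
  then show ?thesis
    by (simp add: form_action_def tensor_sum_def extend_wedge form_ad_sum form_ad_wedge)
qed

text \<open>In the derivation rule for the bracket of x_1, ..., x_(n-1) and \<alpha>^k y, the first
  n - 1 terms form the action of D on the wedge. In the last one D has passed all of the wedge, of
  degree q, and reaches y.\<close>

lemma Der_part_form_ad:
  assumes D: "D \<in> Der_part l p" and f: "f \<in> homogeneous_forms q" and y: "y \<in> V r" and n: "0 < n"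
  shows "D (form_ad k f y) = form_ad (l + k) (form_action (n - 1) l p D f) y
    + scale (koszul (p * q)) (form_ad k ((form_alpha ^^ l) f) (D y))"
  using f
proof (induction rule: homogeneous_forms_induct)
  case subspace
  show ?case
    by (simp add: F.subspace_def form_action_def tensor_sum_def extend_zero extend_add extend_scale
        form_ad_zero form_ad_add form_ad_scale form_alpha_pow_linear lin_simps[OF Der_part_lin[OF D]]
        scale_right_distrib mult.commute)
next
  case (wedge xs qs)
  let ?xs = "xs @ [(\<alpha> ^^ k) y]"
  have len: "length qs = n - 1" using wedge list_all2_lengthD by metis
  \<comment> \<open>The bound n is written as \<open>Suc (n - 1)\<close> to split off the term for
    the last slot.\<close>
  have "D (br ?xs) = (\<Sum>i<Suc (n - 1). scale (koszul (p * sum_list (take i (qs @ [r]))))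
      (br ((map (\<alpha> ^^ l) ?xs)[i := D (?xs ! i)])))"
    using Der_partD(3)[OF D _ homogeneous_snoc[OF wedge(2) even_alpha_pow[OF y, of k]]] n wedge(1)
    by simp
  also have "\<dots> = (\<Sum>i<n - 1. scale (koszul (p * sum_list (take i qs)))
        (br ((map (\<alpha> ^^ l) xs)[i := D (xs ! i)] @ [(\<alpha> ^^ (l + k)) y])))
      + scale (koszul (p * q)) (br (map (\<alpha> ^^ l) xs @ [(\<alpha> ^^ k) (D y)]))"
    unfolding sum.lessThan_Suc using wedge(1,3) len
    by (simp add: nth_append list_update_append Der_part_alpha_pow[OF D] funpow_add)
  finally show ?case
    unfolding form_action_wedge[OF Der_partD(1)[OF D] wedge(1,2) n]
    by (simp add: form_ad_wedge form_alpha_pow_wedge)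
qed

lemma supercommutator_form_ad:
  assumes D: "D \<in> Der_part l p" and f: "f \<in> homogeneous_forms q" "f \<in> fixed_forms" and n: "0 < n"
  shows "supercommutator D (form_ad k f) = form_ad (l + k) (form_action (n - 1) l p D f)"
proof (rule lin_eqI)
  have f': "f \<in> forms (n - 1)" by (rule homogeneous_forms_subset[OF f(1)])
  show "lin (supercommutator D (form_ad k f))"
    by (intro lin_supercommutator Der_part_lin[OF D] form_ad_lin n f')
  show "lin (form_ad (l + k) (form_action (n - 1) l p D f))"
    using form_action_fixed[OF f(2) Der_partD(1,2)[OF D]]
    by (intro form_ad_lin n) (simp add: fixed_forms_def)
  fix r y assume y: "y \<in> V r"
  have "form_ad k ((form_alpha ^^ l) f) = form_ad k f"
    by (rule form_ad_cong[OF n form_alpha_pow_fixed[OF f(2)]])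
  then show "supercommutator D (form_ad k f) y = form_ad (l + k) (form_action (n - 1) l p D f) y"
    unfolding supercommutator_homogeneous[OF Der_partD(1)[OF D] form_ad_End_part[OF n f(1)]]
    by (simp add: Der_part_form_ad[OF D f(1) y n])
qed

section \<open>Fixed classes and the spaces of inner derivations\<close>

lemma ext_rel_iff:
  "(f, g) \<in> ext_rel m \<longleftrightarrow> f \<in> forms m \<and> g \<in> forms m \<and> f - g \<in> relations m"
  by (simp add: ext_rel_def)

lemma equiv_ext_rel: "equiv (forms m) (ext_rel m)"
proof (rule equivI)
  show "refl_on (forms m) (ext_rel m)"
    by (auto simp: refl_on_def ext_rel_iff F.span_zero)
  show "sym (ext_rel m)"
    using F.span_neg by (fastforce simp: sym_def ext_rel_iff)
  show "trans (ext_rel m)"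
    using F.span_add by (fastforce simp: trans_def ext_rel_iff)
  show "ext_rel m \<subseteq> forms m \<times> forms m"
    by (auto simp: ext_rel_iff)
qed

text \<open>Congruent representatives have congruent images under \<open>form_alpha\<close>, so the
  union in \<open>ext_alpha\<close> is a single class, and equality of classes is congruence of
  representatives.\<close>

lemma ext_alpha_class_iff:
  assumes "f \<in> forms m"
  shows "ext_alpha m (ext_rel m `` {f}) = ext_rel m `` {f} \<longleftrightarrow> form_alpha f - f \<in> relations m"
proof -
  have "ext_rel m `` {form_alpha g} = ext_rel m `` {form_alpha f}" if "(f, g) \<in> ext_rel m" for g
  proof (rule equiv_class_eq[OF equiv_ext_rel])
    have "form_alpha (g - f) \<in> relations m"
      using that F.span_neg[of "f - g"] by (intro form_alpha_relations) (simp add: ext_rel_iff)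
    then show "(form_alpha g, form_alpha f) \<in> ext_rel m"
      using that by (simp add: ext_rel_iff form_alpha_forms) (simp add: form_alpha_extend extend_minus)
  qed
  moreover have "(f, f) \<in> ext_rel m"
    using assms by (simp add: ext_rel_iff F.span_zero)
  ultimately have "ext_alpha m (ext_rel m `` {f}) = ext_rel m `` {form_alpha f}"
    unfolding ext_alpha_def by blast
  then show ?thesis
    using eq_equiv_class_iff[OF equiv_ext_rel form_alpha_forms[OF assms] assms] assms
    by (simp add: ext_rel_iff form_alpha_forms)
qed

text \<open>The fixed forms are a subspace and \<open>form_ad\<close> is linear in the form, so
  taking the span adds nothing: every element of \<open>Inn k\<close> comes from one fixed
  form.\<close>

lemma Inn_eq:
  assumes n: "0 < n"
  shows "Inn k = form_ad k ` fixed_forms"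
proof -
  have "{ad k X |X. X \<in> ext_power (n - 1) \<and> ext_alpha (n - 1) X = X} = form_ad k ` fixed_forms"
  proof (intro equalityI subsetI)
    fix D assume "D \<in> {ad k X |X. X \<in> ext_power (n - 1) \<and> ext_alpha (n - 1) X = X}"
    then obtain X where X: "D = ad k X" "X \<in> ext_power (n - 1)" "ext_alpha (n - 1) X = X" by blast
    from X(2) obtain f where f: "f \<in> forms (n - 1)" "X = ext_rel (n - 1) `` {f}"
      unfolding ext_power_def by (rule quotientE)
    have "D = form_ad k f" using X(1) f(2) ad_class[OF f(1)] n by simp
    moreover have "f \<in> fixed_forms"
      using X(3) ext_alpha_class_iff[OF f(1)] f by (simp add: fixed_forms_def)
    ultimately show "D \<in> form_ad k ` fixed_forms" by blast
  next
    fix D assume "D \<in> form_ad k ` fixed_forms"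
    then obtain f where f: "D = form_ad k f" "f \<in> forms (n - 1)" "form_alpha f - f \<in> relations (n - 1)"
      by (auto simp: fixed_forms_def)
    have "D = ad k (ext_rel (n - 1) `` {f})" using f(1) ad_class[OF f(2)] n by simp
    moreover have "ext_rel (n - 1) `` {f} \<in> ext_power (n - 1)"
      unfolding ext_power_def using f(2) by (rule quotientI)
    ultimately show "D \<in> {ad k X |X. X \<in> ext_power (n - 1) \<and> ext_alpha (n - 1) X = X}"
      using ext_alpha_class_iff[OF f(2)] f(3) by blast
  qed
  moreover have "E.subspace (form_ad k ` fixed_forms)"
  proof (rule E.subspaceI)
    have "0 \<in> fixed_forms"
      using F.subspace_0[OF subspace_forms]
      by (simp add: fixed_forms_def form_alpha_extend extend_zero F.span_zero)
    moreover have "0 = form_ad k 0" by (simp add: fun_eq_iff form_ad_zero)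
    ultimately show "0 \<in> form_ad k ` fixed_forms" by blast
  next
    fix D E assume "D \<in> form_ad k ` fixed_forms" "E \<in> form_ad k ` fixed_forms"
    then obtain f g where fg: "D = form_ad k f" "E = form_ad k g" "f \<in> fixed_forms" "g \<in> fixed_forms"
      by blast
    have "form_alpha (f + g) - (f + g) = (form_alpha f - f) + (form_alpha g - g)"
      by (simp add: form_alpha_extend extend_add)
    also have "\<dots> \<in> relations (n - 1)"
      by (rule F.span_add) (use fg in \<open>simp_all add: fixed_forms_def\<close>)
    finally have "f + g \<in> fixed_forms"
      using fg F.subspace_add[OF subspace_forms] by (simp add: fixed_forms_def)
    moreover have "D + E = form_ad k (f + g)" by (simp add: fg fun_eq_iff form_ad_add)
    ultimately show "D + E \<in> form_ad k ` fixed_forms" by blast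
  next
    fix c D assume "D \<in> form_ad k ` fixed_forms"
    then obtain f where f: "D = form_ad k f" "f \<in> fixed_forms" by blast
    have "form_alpha (form_scale c f) - form_scale c f = form_scale c (form_alpha f - f)"
      by (simp add: form_alpha_extend extend_scale F.scale_right_diff_distrib)
    also have "\<dots> \<in> relations (n - 1)"
      by (rule F.span_scale) (use f in \<open>simp add: fixed_forms_def\<close>)
    finally have "form_scale c f \<in> fixed_forms"
      using f F.subspace_scale[OF subspace_forms] by (simp add: fixed_forms_def)
    moreover have "End_scale c D = form_ad k (form_scale c f)" by (simp add: f fun_eq_iff form_ad_scale)
    ultimately show "End_scale c D \<in> form_ad k ` fixed_forms" by blast
  qed
  ultimately show ?thesis
    unfolding Inn_def by (simp only: E.span_eq_iff)
qed

lemma Inn_zero: "0 \<in> Inn k"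
  unfolding Inn_def by (rule E.span_zero)

lemma Inn_add: "D \<in> Inn k \<Longrightarrow> E \<in> Inn k \<Longrightarrow> D + E \<in> Inn k"
  unfolding Inn_def by (rule E.span_add)

lemma Inn_scale: "D \<in> Inn k \<Longrightarrow> End_scale c D \<in> Inn k"
  unfolding Inn_def by (rule E.span_scale)

lemma Inn_sum_closed: "(\<And>t. t \<in> T \<Longrightarrow> f t \<in> Inn k) \<Longrightarrow> sum f T \<in> Inn k"
  unfolding Inn_def by (rule E.span_sum)

text \<open>A form of degree q gives an endomorphism of degree q, so the component of an inner
  derivation comes from the component of its form, which is again fixed.\<close>

lemma End_proj_Inn:
  assumes "E \<in> Inn k" "0 < n"
  obtains f where "f \<in> homogeneous_forms q" "f \<in> fixed_forms" "End_proj q E = form_ad k f"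
proof -
  obtain f where f: "f \<in> fixed_forms" "E = form_ad k f"
    using assms by (auto simp: Inn_eq)
  then have f': "f \<in> forms (n - 1)" by (simp add: fixed_forms_def)
  note End = form_ad_End_part[OF assms(2) form_proj_homogeneous[OF f']]
  have "End_proj q E = End_proj q (form_ad k (form_proj (n - 1) 0 f))
      + End_proj q (form_ad k (form_proj (n - 1) 1 f))"
    unfolding f(2) End_proj_add[symmetric] form_ad_proj_sum[OF assms(2) f'] ..
  also have "\<dots> = form_ad k (form_proj (n - 1) q f)"
    unfolding End_proj_homogeneous[OF End] by (cases q) simp_all
  finally show thesis
    using that form_proj_homogeneous[OF f'] form_proj_fixed[OF f(1)] by blast
qed

lemma Inn_subset_Der:
  assumes "E \<in> Inn k" "0 < n"
  shows "E \<in> Der (Suc k)"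
  unfolding Der_iff
proof (intro conjI allI)
  show "lin E"
    using assms form_ad_lin by (auto simp: Inn_eq fixed_forms_def)
  fix p
  show "End_proj p E \<in> Der_part (Suc k) p"
    using End_proj_Inn[OF assms, of p] form_ad_Der_part[OF assms(2)] by metis
qed

text \<open>On homogeneous components this is \<open>supercommutator_form_ad\<close>, and
  skew-symmetry gives the other order. As \<open>Inn k\<close> belongs to the summand
  \<open>Suc k\<close>, the index l + k belongs to the summand l + \<open>Suc k\<close>, as the
  bracket requires.\<close>

lemma supercommutator_Inn:
  assumes D: "D \<in> Der l" and E: "E \<in> Inn k" and n: "0 < n"
  shows "supercommutator D E \<in> Inn (l + k)" "supercommutator E D \<in> Inn (l + k)"
proof -
  have lin: "lin D" "lin E"
    using D Inn_subset_Der[OF E n] by (auto intro: Der_lin)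
  have *: "supercommutator (End_proj p D) (End_proj q E) \<in> Inn (l + k)" for p q
  proof -
    obtain f where f: "f \<in> homogeneous_forms q" "f \<in> fixed_forms" "End_proj q E = form_ad k f"
      by (rule End_proj_Inn[OF E n])
    have Dp: "End_proj p D \<in> Der_part l p" using D by (simp add: Der_iff)
    have "form_action (n - 1) l p (End_proj p D) f \<in> fixed_forms"
      using Der_partD(1,2)[OF Dp] by (intro form_action_fixed f(2))
    then show ?thesis
      unfolding f(3) supercommutator_form_ad[OF Dp f(1,2) n] Inn_eq[OF n] by (rule imageI)
  qed
  show "supercommutator D E \<in> Inn (l + k)"
    unfolding supercommutator_decompose[OF lin] by (intro Inn_add *)
  have "supercommutator (End_proj q E) (End_proj p D) \<in> Inn (l + k)" for p q
  proof -
    have "supercommutator (End_proj q E) (End_proj p D)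
        = End_scale (- koszul (q * p)) (supercommutator (End_proj p D) (End_proj q E))"
      unfolding supercommutator_skew[OF End_proj_in End_proj_in, OF lin(2,1)]
      by (simp add: fun_eq_iff)
    then show ?thesis using Inn_scale[OF *] by (simp only:)
  qed
  then show "supercommutator E D \<in> Inn (l + k)"
    unfolding supercommutator_decompose[OF lin(2,1)] by (intro Inn_add)
qed

section \<open>The ideal in the direct sum\<close>

lemma Inn_sum_subset:
  assumes "0 < n"
  shows "Inn_sum \<subseteq> Der_sum"
proof
  fix D assume D: "D \<in> Inn_sum"
  have "D k \<in> Der k" for k
    using D Inn_subset_Der[OF _ assms] Der_zero by (cases k) (auto simp: Inn_sum_def)
  with D show "D \<in> Der_sum" by (simp add: Der_sum_def Inn_sum_def)
qed

lemma Der_bracket_Inn_sum: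
  assumes D: "D \<in> Der_sum" and E: "E \<in> Inn_sum" and n: "0 < n"
  shows "Der_bracket D E \<in> Inn_sum" "Der_bracket E D \<in> Inn_sum"
proof -
  have E': "E \<in> Der_sum" using E Inn_sum_subset[OF n] by blast
  have fin: "finite {k. Der_bracket D E k \<noteq> 0}" "finite {k. Der_bracket E D k \<noteq> 0}"
    using Der_bracket_closed[OF D E'] Der_bracket_closed[OF E' D] by (simp_all add: Der_sum_def)
  have E0: "E 0 = 0" and ES: "E (Suc k) \<in> Inn k" for k
    using E by (simp_all add: Inn_sum_def)
  have DD: "D k \<in> Der k" for k using D by (simp add: Der_sum_def)
  have "Der_bracket D E 0 = 0" "Der_bracket E D 0 = 0"
    using supercommutator_zero_right[OF Der_lin[OF DD]] supercommutator_zero_left[OF Der_lin[OF DD]]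
    by (simp_all add: Der_bracket_def E0)
  \<comment> \<open>The term with \<open>E 0\<close> vanishes; in all others
    \<open>Suc m - k\<close> is \<open>Suc (m - k)\<close>, so that entry of E lies in
    \<open>Inn (m - k)\<close>, and the indices k and m - k add up to m.\<close>
  moreover have "supercommutator (D k) (E (Suc m - k)) \<in> Inn m" if "k \<le> Suc m" for k m
  proof (cases "k = Suc m")
    case True
    then show ?thesis
      using supercommutator_zero_right[OF Der_lin[OF DD]] by (simp add: E0 Inn_zero)
  next
    case False
    with that supercommutator_Inn(1)[OF DD[of k] ES[of "m - k"] n] show ?thesis
      by (simp add: Suc_diff_le)
  qed
  then have "Der_bracket D E (Suc m) \<in> Inn m" for m
    unfolding Der_bracket_def by (intro Inn_sum_closed) simp
  moreover have "supercommutator (E k) (D (Suc m - k)) \<in> Inn m" if "k \<le> Suc m" for k m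
  proof (cases k)
    case 0
    then show ?thesis
      using supercommutator_zero_left[OF Der_lin[OF DD]] by (simp add: E0 Inn_zero)
  next
    case (Suc j)
    with that supercommutator_Inn(2)[OF DD[of "m - j"] ES[of j] n] show ?thesis by simp
  qed
  then have "Der_bracket E D (Suc m) \<in> Inn m" for m
    unfolding Der_bracket_def by (intro Inn_sum_closed) simp
  ultimately show "Der_bracket D E \<in> Inn_sum" "Der_bracket E D \<in> Inn_sum"
    using fin by (simp_all add: Inn_sum_def)
qed

lemma Inn_sum_component:
  assumes D: "D \<in> Inn_sum" and E: "E \<in> Der_sum" "\<And>k. E k = End_proj p (D k)" and n: "0 < n"
  shows "E \<in> Inn_sum"
proof -
  have "End_proj p (D (Suc k)) \<in> Inn k" for k
  proof -
    have "D (Suc k) \<in> Inn k" using D by (simp add: Inn_sum_def)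
    then obtain f where "f \<in> fixed_forms" "End_proj p (D (Suc k)) = form_ad k f"
      by (rule End_proj_Inn[OF _ n])
    then show ?thesis by (simp add: Inn_eq[OF n])
  qed
  then show ?thesis
    using D E by (simp add: Inn_sum_def Der_sum_def End_proj_zero)
qed

lemma ideal_Inn_sum:
  assumes n: "0 < n"
  shows "lie_superalgebra.ideal sum_scale Der_sum Der_sum_part Der_bracket Inn_sum"
  unfolding lie_superalgebra.ideal_def[OF lie_superalgebra_Der_sum]
proof (intro conjI ballI impI)
  interpret S: vector_space sum_scale by (rule vector_space_sum)
  show "S.subspace Inn_sum"
  proof (rule S.subspaceI)
    show "0 \<in> Inn_sum" by (simp add: Inn_sum_def Inn_zero)
    fix D E assume DE: "D \<in> Inn_sum" "E \<in> Inn_sum"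
    have "D + E \<in> Der_sum" using DE Inn_sum_subset[OF n] Der_sum_add by blast
    with DE show "D + E \<in> Inn_sum" by (simp add: Inn_sum_def Der_sum_def Inn_add)
  next
    fix c D assume D: "D \<in> Inn_sum"
    have "sum_scale c D \<in> Der_sum" using D Inn_sum_subset[OF n] Der_sum_scale by blast
    with D show "sum_scale c D \<in> Inn_sum"
      by (simp add: Inn_sum_def Der_sum_def Inn_scale) (simp add: fun_eq_iff)
  qed
  show "Inn_sum \<subseteq> Der_sum" by (rule Inn_sum_subset[OF n])
next
  fix x y assume xy: "x \<in> Der_sum_part 0" "y \<in> Der_sum_part 1" "x + y \<in> Inn_sum"
  have "x \<in> Der_sum" "y \<in> Der_sum" using xy by (simp_all add: Der_sum_part_def)
  \<comment> \<open>The homogeneous summands are recovered as the components of the sum, and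
    components of inner derivations are inner.\<close>
  moreover have "x k = End_proj 0 ((x + y) k)" "y k = End_proj 1 ((x + y) k)" for k
    by (simp_all add: End_proj_add End_proj_homogeneous[OF Der_sum_part_End[OF xy(1)]]
        End_proj_homogeneous[OF Der_sum_part_End[OF xy(2)]])
  ultimately show "x \<in> Inn_sum" "y \<in> Inn_sum"
    using Inn_sum_component[OF xy(3) _ _ n] by blast+
next
  fix x y assume "x \<in> Der_sum" "y \<in> Inn_sum"
  then show "Der_bracket x y \<in> Inn_sum" "Der_bracket y x \<in> Inn_sum"
    by (rule Der_bracket_Inn_sum[OF _ _ n])+
qed

end

theorem proposition2p4:
  fixes scale :: "'k::field \<Rightarrow> 'v::ab_group_add \<Rightarrow> 'v"
    and V :: "bit \<Rightarrow> 'v set"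
    and n :: nat
    and br :: "'v list \<Rightarrow> 'v"
    and \<alpha> :: "'v \<Rightarrow> 'v"
  assumes "n \<ge> 2"
    and "hom_nambu_lie_superalgebra scale V n br \<alpha>"
  shows "lie_superalgebra
      (\<lambda>c D k x. scale c (D k x))
      (hom_nambu_lie_superalgebra.Der_sum scale V n br \<alpha>)
      (hom_nambu_lie_superalgebra.Der_sum_part scale V n br \<alpha>)
      (hom_nambu_lie_superalgebra.Der_bracket scale V)
    \<and> lie_superalgebra.ideal
      (\<lambda>c D k x. scale c (D k x))
      (hom_nambu_lie_superalgebra.Der_sum scale V n br \<alpha>)
      (hom_nambu_lie_superalgebra.Der_sum_part scale V n br \<alpha>)
      (hom_nambu_lie_superalgebra.Der_bracket scale V)
      (hom_nambu_lie_superalgebra.Inn_sum scale V n br \<alpha>)"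
proof -
  interpret hom_nambu_lie_superalgebra scale V n br \<alpha> by fact
  show ?thesis
    using lie_superalgebra_Der_sum ideal_Inn_sum assms(1) by simp
qed

end
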